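(* $\mathsf{TT}^2_2$ does not admit fairness preservation. More precisely, there are a $\Delta^0_2$ partition $A_0\cup A_1=2^{<\omega}$ such that $\emptyset$ is $1$-fair for $A_0,A_1$, and a computable coloring $f:[2^{<\omega}]^2\to 2$, with the following property: for every $f$-homogeneous set $S$ (and witnessing isomorphism $g$), the set $S$ is not $n$-fair for $A_0,A_1$ for any $n\ge1$.
   Context: $[2^{<\omega}]^2$ denotes the set of pairs $\{\sigma,\tau\}$ of binary strings with $\sigma\prec\tau$. A set $S\subseteq 2^{<\omega}$ is $f$-homogeneous if $f$ is constant on $[S]^2$ and $S\cong 2^{<\omega}$, witnessed by a bijection $g:2^{<\omega}\to S$ with $\sigma\preceq\tau\iff g(\sigma)\preceq g(\tau)$. $\mathsf{TT}^2_2$ is the statement that every $f:[2^{<\omega}]^2\to2$ has an $f$-homogeneous set; a solution is such a set together with its isomorphism $g$. Strings are finite binary strings, and $\preceq$ is the prefix relation. Matrices. An $m$-by-$n$ matrix $M$ is an array of strings $\sigma_{i,j}$ ($i<m$, $j<n$), with rows $M(i)=(\sigma_{i,0},\dots,\sigma_{i,n-1})$. It is disjoint if each row consists of pairwise incomparable strings. Formulas. An $m$-by-$n$ formula is a formula with distinguished finite-set variables $U_{i,j}$. It is $\Sigma^{0,X}_1$ if it is $\Sigma^0_1$ relative to $X$. Valuations. An $M$-valuation is a tuple $V=(B_{i,j})$ of finite sets $B_{i,j}\subseteq\{\tau:\tau\succeq\sigma_{i,j}\}$. We write $\varphi(V)$ for $\varphi$ evaluated at $U_{i,j}:=B_{i,j}$,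 and $V(i)=(B_{i,0},\dots,B_{i,n-1})$. We write $V>s$ if all strings occurring in $V$ have length $>s$. Essential. $\varphi$ is essential in $M$ if for every $s$ there is an $M$-valuation $V>s$ with $\varphi(V)$. Diagonalization. An $M$-valuation $V$ diagonalizes against $A_0,A_1$ if for every $i<m$ there are components $L,R$ of $V(i)$ with $L\subseteq A_0$ and $R\subseteq A_1$. Fairness. For $n\ge1$, a set $X$ is $n$-fair for $A_0,A_1$ if the following holds: for every $m$, every $\Sigma^{0,X}_1$ $m$-by-$2^nm$ formula $\varphi$, and every $m$-by-$2^nm$ disjoint matrix $M$ in which $\varphi$ is essential, there is an $M$-valuation $V$ diagonalizing against $A_0,A_1$ with $\varphi(V)$. The set $X$ is fair if it is $n$-fair for some $n\ge1$. Preservation. A $\Pi^1_2$ problem $\mathsf P$ admits fairness preservation if for all $A_0,A_1\subseteq2^{<\omega}$, every $C$ fair for $A_0,A_1$, and every $C$-computable $\mathsf P$-instance $X$, there is a solution $Y$ to $X$ with $Y\oplus C$ fair for $A_0,A_1$. *)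

theory Defs
  imports Main "HOL-Library.Nat_Bijection" "HOL-Library.Sublist"
begin

datatype rf = Zf | Sf | Pj nat | Cn rf "rf list" | Pr rf rf | Mn rf | Orc

definition arg :: "nat \<Rightarrow> nat list \<Rightarrow> nat" where
  "arg i xs = (if i < length xs then xs ! i else 0)"

inductive ev :: "nat set \<Rightarrow> rf \<Rightarrow> nat list \<Rightarrow> nat \<Rightarrow> bool" for X where
  ev_Z: "ev X Zf xs 0"
| ev_S: "ev X Sf xs (Suc (arg 0 xs))"
| ev_Pj: "ev X (Pj i) xs (arg i xs)"
| ev_Cn: "length ys = length gs \<Longrightarrow> (\<forall>i<length gs. ev X (gs ! i) xs (ys ! i))
          \<Longrightarrow> ev X f ys z \<Longrightarrow> ev X (Cn f gs) xs z"
| ev_Pr0: "ev X g xs z \<Longrightarrow> ev X (Pr g h) (0 # xs) z"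
| ev_PrS: "ev X (Pr g h) (n # xs) y \<Longrightarrow> ev X h (n # y # xs) z
          \<Longrightarrow> ev X (Pr g h) (Suc n # xs) z"
| ev_Mn: "ev X f (n # xs) 0 \<Longrightarrow> (\<forall>k<n. \<exists>v. ev X f (k # xs) v \<and> 0 < v)
          \<Longrightarrow> ev X (Mn f) xs n"
| ev_Orc: "ev X Orc xs (if arg 0 xs \<in> X then 1 else 0)"

definition computable_in :: "nat set \<Rightarrow> (nat \<Rightarrow> nat) \<Rightarrow> bool" where
  "computable_in X F \<longleftrightarrow> (\<exists>p. \<forall>x. ev X p [x] (F x))"

definition computable_set :: "nat set \<Rightarrow> bool" where
  "computable_set R \<longleftrightarrow> computable_in {} (\<lambda>x. if x \<in> R then 1 else 0)"

definition sigma01_in :: "nat set \<Rightarrow> nat set \<Rightarrow> bool" where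
  "sigma01_in X S \<longleftrightarrow> (\<exists>p. \<forall>x. x \<in> S \<longleftrightarrow> (\<exists>y. ev X p [x] y))"

definition sigma02 :: "nat set \<Rightarrow> bool" where
  "sigma02 S \<longleftrightarrow> (\<exists>R. computable_set R \<and>
      (\<forall>x. x \<in> S \<longleftrightarrow> (\<exists>y. \<forall>z. prod_encode (x, prod_encode (y, z)) \<in> R)))"

definition delta02 :: "nat set \<Rightarrow> bool" where
  "delta02 S \<longleftrightarrow> sigma02 S \<and> sigma02 (- S)"

type_synonym str = "bool list"

fun str_code :: "str \<Rightarrow> nat" where
  "str_code [] = 0"
| "str_code (b # s) = 2 * str_code s + (if b then 2 else 1)"

definition fset_code :: "str set \<Rightarrow> nat" where
  "fset_code B = set_encode (str_code ` B)"

text \<open>A 2-colouring of [2^{<omega}]^2 is a function f; only its values on pairs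
  sigma strictly below tau matter.\<close>
definition computable_coloring :: "(str \<Rightarrow> str \<Rightarrow> bool) \<Rightarrow> bool" where
  "computable_coloring f \<longleftrightarrow> computable_in {}
     (\<lambda>n. case prod_decode n of (a, b) \<Rightarrow>
        if f (inv str_code a) (inv str_code b) then 1 else 0)"

definition homogeneous :: "(str \<Rightarrow> str \<Rightarrow> bool) \<Rightarrow> str set \<Rightarrow> (str \<Rightarrow> str) \<Rightarrow> bool" where
  "homogeneous f S g \<longleftrightarrow>
     (\<exists>c. \<forall>\<sigma>\<in>S. \<forall>\<tau>\<in>S. strict_prefix \<sigma> \<tau> \<longrightarrow> f \<sigma> \<tau> = c) \<and>
     bij_betw g UNIV S \<and> (\<forall>\<sigma> \<tau>. prefix \<sigma> \<tau> \<longleftrightarrow> prefix (g \<sigma>) (g \<tau>))"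

definition disjoint_matrix :: "nat \<Rightarrow> nat \<Rightarrow> (nat \<Rightarrow> nat \<Rightarrow> str) \<Rightarrow> bool" where
  "disjoint_matrix m k M \<longleftrightarrow>
     (\<forall>i<m. \<forall>j<k. \<forall>j'<k. j \<noteq> j' \<longrightarrow> parallel (M i j) (M i j'))"

definition valuation :: "nat \<Rightarrow> nat \<Rightarrow> (nat \<Rightarrow> nat \<Rightarrow> str) \<Rightarrow> (nat \<Rightarrow> nat \<Rightarrow> str set) \<Rightarrow> bool" where
  "valuation m k M V \<longleftrightarrow>
     (\<forall>i<m. \<forall>j<k. finite (V i j) \<and> V i j \<subseteq> {\<tau>. prefix (M i j) \<tau>})"

definition val_gt :: "nat \<Rightarrow> nat \<Rightarrow> (nat \<Rightarrow> nat \<Rightarrow> str set) \<Rightarrow> nat \<Rightarrow> bool" where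
  "val_gt m k V s \<longleftrightarrow> (\<forall>i<m. \<forall>j<k. \<forall>\<tau>\<in>V i j. s < length \<tau>)"

definition val_code :: "nat \<Rightarrow> nat \<Rightarrow> (nat \<Rightarrow> nat \<Rightarrow> str set) \<Rightarrow> nat" where
  "val_code m k V = list_encode (map (\<lambda>i. list_encode (map (\<lambda>j. fset_code (V i j)) [0..<k])) [0..<m])"

text \<open>An m-by-k formula phi (viewed semantically as a predicate of the finite-set
  variables U_{i,j}) is Sigma^{0,X}_1 if its truth on tuples of finite sets is
  given by membership of the code of the tuple in a Sigma^0_1(X) set.\<close>
definition sigma01_formula :: "nat set \<Rightarrow> nat \<Rightarrow> nat \<Rightarrow> ((nat \<Rightarrow> nat \<Rightarrow> str set) \<Rightarrow> bool) \<Rightarrow> bool" where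
  "sigma01_formula X m k \<phi> \<longleftrightarrow> (\<exists>W. sigma01_in X W \<and>
     (\<forall>V. (\<forall>i<m. \<forall>j<k. finite (V i j)) \<longrightarrow> (\<phi> V \<longleftrightarrow> val_code m k V \<in> W)))"

definition essential :: "nat \<Rightarrow> nat \<Rightarrow> ((nat \<Rightarrow> nat \<Rightarrow> str set) \<Rightarrow> bool) \<Rightarrow> (nat \<Rightarrow> nat \<Rightarrow> str) \<Rightarrow> bool" where
  "essential m k \<phi> M \<longleftrightarrow> (\<forall>s. \<exists>V. valuation m k M V \<and> val_gt m k V s \<and> \<phi> V)"

definition diagonalizes :: "nat \<Rightarrow> nat \<Rightarrow> (nat \<Rightarrow> nat \<Rightarrow> str set) \<Rightarrow> str set \<Rightarrow> str set \<Rightarrow> bool" where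
  "diagonalizes m k V A0 A1 \<longleftrightarrow>
     (\<forall>i<m. \<exists>l<k. \<exists>r<k. V i l \<subseteq> A0 \<and> V i r \<subseteq> A1)"

definition n_fair :: "nat \<Rightarrow> nat set \<Rightarrow> str set \<Rightarrow> str set \<Rightarrow> bool" where
  "n_fair n X A0 A1 \<longleftrightarrow>
     (\<forall>m \<phi> M. sigma01_formula X m (2 ^ n * m) \<phi> \<longrightarrow> disjoint_matrix m (2 ^ n * m) M \<longrightarrow>
        essential m (2 ^ n * m) \<phi> M \<longrightarrow>
        (\<exists>V. valuation m (2 ^ n * m) M V \<and> diagonalizes m (2 ^ n * m) V A0 A1 \<and> \<phi> V))"

end

theory Submission
  imports Defs
begin

text \<open>The set \<open>A1\<close> is built in stages relative to the halting problem. Stage \<open>e\<close> asks whether the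
  \<open>e\<close>-th c.e. family of pairs \<open>(L, R)\<close> of disjoint finite sets has a member above all strings decided
  so far; if so, the first one found puts \<open>R\<close> into \<open>A1\<close> and keeps \<open>L\<close> out. A family with
  arbitrarily large members always gets a positive answer, so no injury occurs, and bounding the
  search by \<open>b\<close> gives a computable approximation of \<open>A1\<close>. For a disjoint \<open>m\<close>-by-\<open>2m\<close>
  matrix one can select two entries in each row so that all \<open>2m\<close> selected entries are pairwise
  incomparable; the selected components of the valuations satisfying an essential formula then form
  such a family, which yields 1-fairness of \<open>{}\<close>.

  The colouring \<open>f \<sigma> \<tau>\<close> is the approximation of \<open>\<sigma> \<in> A1\<close> at stage \<open>\<tau>\<close>. A homogeneous \<open>S\<close>
  contains arbitrarily late extensions of each of its members, so it lies inside \<open>A0\<close> or \<open>A1\<close>.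
  The formula saying that every component meets \<open>S\<close> is then essential in each row of incomparable
  members of \<open>S\<close>, but no valuation satisfying it diagonalizes.\<close>

section \<open>Closure properties of computable functions\<close>

abbreviation pfst :: "nat \<Rightarrow> nat" where "pfst n \<equiv> fst (prod_decode n)"
abbreviation psnd :: "nat \<Rightarrow> nat" where "psnd n \<equiv> snd (prod_decode n)"

definition computable2_in :: "nat set \<Rightarrow> (nat \<Rightarrow> nat \<Rightarrow> nat) \<Rightarrow> bool" where
  "computable2_in X F \<longleftrightarrow> (\<exists>p. \<forall>x y. ev X p [x, y] (F x y))"

definition decidable_in :: "nat set \<Rightarrow> (nat \<Rightarrow> bool) \<Rightarrow> bool" where
  "decidable_in X P \<longleftrightarrow> computable_in X (\<lambda>x. if P x then 1 else 0)"

lemma ev_Pj_eq: "z = arg i xs \<Longrightarrow> ev X (Pj i) xs z"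
  by (simp add: ev_Pj)

lemma ev_Sf_eq: "z = Suc (arg 0 xs) \<Longrightarrow> ev X Sf xs z"
  by (simp add: ev_S)

lemma ev_Cn1: "ev X g xs a \<Longrightarrow> ev X f [a] z \<Longrightarrow> ev X (Cn f [g]) xs z"
  by (rule ev_Cn[where ys = "[a]"]) auto

lemma ev_Cn2:
  "ev X g xs a \<Longrightarrow> ev X h xs b \<Longrightarrow> ev X f [a, b] z \<Longrightarrow> ev X (Cn f [g, h]) xs z"
  by (rule ev_Cn[where ys = "[a, b]"]) (auto simp: less_Suc_eq)

lemma ev_Cn_Sf: "ev X g xs a \<Longrightarrow> ev X (Cn Sf [g]) xs (Suc a)"
  by (rule ev_Cn1, assumption, rule ev_Sf_eq) (simp add: arg_def)

text \<open>Ties \<open>Pr\<close> to \<open>rec_nat\<close>: afterwards a program is verified by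
  proving an equation about \<open>rec_nat\<close>.\<close>

lemma ev_Pr_rec:
  assumes "ev X g xs a" "\<And>n y. ev X h (n # y # xs) (H n y)"
  shows "ev X (Pr g h) (n # xs) (rec_nat a H n)"
  by (induction n) (auto intro: ev_Pr0 ev_PrS assms)

lemma arg_simps [simp]: "arg 0 (x # xs) = x" "arg (Suc i) (x # xs) = arg i xs" "arg i [] = 0"
  by (auto simp: arg_def)

lemma computable_in_id: "computable_in X (\<lambda>x. x)"
  unfolding computable_in_def by (rule exI[of _ "Pj 0"]) (auto intro: ev_Pj_eq)

lemma computable_in_comp:
  "computable_in X F \<Longrightarrow> computable_in X G \<Longrightarrow> computable_in X (\<lambda>x. F (G x))"
  unfolding computable_in_def by (meson ev_Cn1)

lemma computable_in_comp2:
  assumes "computable2_in X f" "computable_in X F" "computable_in X G"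
  shows "computable_in X (\<lambda>x. f (F x) (G x))"
proof -
  obtain p q r where "\<And>x y. ev X p [x, y] (f x y)" "\<And>x. ev X q [x] (F x)" "\<And>x. ev X r [x] (G x)"
    using assms unfolding computable_in_def computable2_in_def by blast
  then have "ev X (Cn p [q, r]) [x] (f (F x) (G x))" for x
    by (rule ev_Cn2[rotated 2])
  then show ?thesis
    unfolding computable_in_def by blast
qed

lemma computable_in_Suc: "computable_in X F \<Longrightarrow> computable_in X (\<lambda>x. Suc (F x))"
  unfolding computable_in_def by (meson ev_Cn_Sf)

lemma computable_in_const: "computable_in X (\<lambda>x. c)"
proof (induction c)
  case 0
  show ?case unfolding computable_in_def by (rule exI[of _ Zf]) (auto intro: ev_Z)
next
  case (Suc c)
  then show ?case by (rule computable_in_Suc)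
qed

section \<open>Programs for arithmetic and Cantor pairing\<close>

definition plus_rf :: rf where "plus_rf = Pr (Pj 0) (Cn Sf [Pj 1])"
definition pred_rf :: rf where "pred_rf = Pr Zf (Pj 0)"
text \<open>\<open>Pr\<close> recurses on its first argument, so the predecessor is iterated with
  the subtrahend in front; the outer \<open>Cn\<close> swaps the two arguments.\<close>

definition minus_rf :: rf where "minus_rf = Cn (Pr (Pj 0) (Cn pred_rf [Pj 1])) [Pj 1, Pj 0]"
definition triangle_rf :: rf where "triangle_rf = Pr Zf (Cn plus_rf [Cn Sf [Pj 0], Pj 1])"
definition pair_rf :: rf where "pair_rf = Cn plus_rf [Cn triangle_rf [plus_rf], Pj 0]"

lemma ev_plus_rf: "ev X plus_rf [x, y] (x + y)"
proof -
  have "ev X plus_rf [x, y] (rec_nat y (\<lambda>_ z. Suc z) x)"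
    unfolding plus_rf_def by (rule ev_Pr_rec) (auto intro!: ev_Pj_eq ev_Cn_Sf)
  also have "rec_nat y (\<lambda>_ z. Suc z) x = x + y" by (induction x) auto
  finally show ?thesis .
qed

lemma ev_pred_rf: "ev X pred_rf [x] (x - 1)"
proof -
  have "ev X pred_rf [x] (rec_nat 0 (\<lambda>n _. n) x)"
    unfolding pred_rf_def by (rule ev_Pr_rec) (auto intro!: ev_Pj_eq ev_Z)
  also have "rec_nat 0 (\<lambda>n _. n) x = x - 1" by (cases x) auto
  finally show ?thesis .
qed

lemma ev_minus_rf: "ev X minus_rf [x, y] (x - y)"
proof -
  have "ev X (Pr (Pj 0) (Cn pred_rf [Pj 1])) [y, x] (rec_nat x (\<lambda>_ z. z - 1) y)"
    by (rule ev_Pr_rec) (auto intro!: ev_Pj_eq ev_Cn1[OF _ ev_pred_rf, simplified])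
  also have "rec_nat x (\<lambda>_ z. z - 1) y = x - y" by (induction y) auto
  finally show ?thesis
    unfolding minus_rf_def by (auto intro!: ev_Cn2 ev_Pj)
qed

lemma ev_triangle_rf: "ev X triangle_rf [x] (triangle x)"
proof -
  have "ev X triangle_rf [x] (rec_nat 0 (\<lambda>n y. Suc n + y) x)"
    unfolding triangle_rf_def
    by (rule ev_Pr_rec) (intro ev_Z ev_Cn2[OF _ _ ev_plus_rf] ev_Cn_Sf ev_Pj_eq; simp)+
  also have "rec_nat 0 (\<lambda>n y. Suc n + y) x = triangle x" by (induction x) auto
  finally show ?thesis .
qed

lemma ev_pair_rf: "ev X pair_rf [x, y] (prod_encode (x, y))"
  unfolding pair_rf_def prod_encode_def prod.case
  by (intro ev_Cn2[OF _ _ ev_plus_rf] ev_Cn1[OF ev_plus_rf] ev_triangle_rf ev_Pj_eq) simp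

lemma computable_in_plus:
  "computable_in X F \<Longrightarrow> computable_in X G \<Longrightarrow> computable_in X (\<lambda>x. F x + G x)"
  using ev_plus_rf by (intro computable_in_comp2[of X "(+)"]) (auto simp: computable2_in_def)

lemma computable_in_minus:
  "computable_in X F \<Longrightarrow> computable_in X G \<Longrightarrow> computable_in X (\<lambda>x. F x - G x)"
  using ev_minus_rf by (intro computable_in_comp2[of X "(-)"]) (auto simp: computable2_in_def)

lemma computable_in_prod_encode:
  "computable_in X F \<Longrightarrow> computable_in X G \<Longrightarrow> computable_in X (\<lambda>x. prod_encode (F x, G x))"
  using ev_pair_rf by (intro computable_in_comp2[of X "\<lambda>x y. prod_encode (x, y)"]) (auto simp: computable2_in_def)

lemma computable_in_triangle: "computable_in X F \<Longrightarrow> computable_in X (\<lambda>x. triangle (F x))"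
  using ev_triangle_rf by (intro computable_in_comp[of X triangle F]) (auto simp: computable_in_def)

text \<open>The diagonal index of \<open>prod_decode n\<close>: it increases exactly when \<open>n\<close> reaches the next
  triangular number.\<close>

lemma diagonal_eq_rec:
  "pfst n + psnd n = rec_nat 0 (\<lambda>n y. y + (1 - (triangle (Suc y) - Suc n))) n"
proof (induction n)
  case 0
  have "prod_decode 0 = (0, 0)" by (simp add: prod_decode_def prod_decode_aux.simps)
  then show ?case by simp
next
  case (Suc n)
  define a b where "a = pfst n" and "b = psnd n"
  have n: "n = triangle (a + b) + a"
    using prod_decode_inverse[of n] by (simp add: a_def b_def prod_encode_def split_beta)
  \<comment> \<open>Cantor pairing walks along a diagonal with \<open>a\<close> growing and
    \<open>b\<close> shrinking; after \<open>b = 0\<close> it jumps to the start of the next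
    diagonal.\<close>
  have "Suc n = prod_encode (if b = 0 then (0, Suc a) else (Suc a, b - 1))"
    using n by (cases b) (auto simp: prod_encode_def)
  from arg_cong[OF this, of prod_decode]
  have "prod_decode (Suc n) = (if b = 0 then (0, Suc a) else (Suc a, b - 1))"
    by (simp only: prod_encode_inverse)
  \<comment> \<open>The inner truncated difference equals \<open>b\<close>, so subtracting it from 1
    tests \<open>b = 0\<close>.\<close>
  moreover have "1 - (triangle (Suc (a + b)) - Suc n) = (if b = 0 then 1 else 0)"
    using n by auto
  ultimately show ?case
    using Suc by (simp flip: a_def b_def)
qed

lemma computable_in_diagonal: "computable_in X (\<lambda>x. pfst x + psnd x)"
proof -
  define one where "one = Cn Sf [Zf]"
  define h where "h = Cn plus_rf [Pj 1, Cn minus_rf [one,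
    Cn minus_rf [Cn triangle_rf [Cn Sf [Pj 1]], Cn Sf [Pj 0]]]]"
  have "ev X (Pr Zf h) [x] (rec_nat 0 (\<lambda>n y. y + (1 - (triangle (Suc y) - Suc n))) x)" for x
    unfolding h_def one_def One_nat_def
    by (rule ev_Pr_rec)
      (intro ev_Z ev_Cn2[OF _ _ ev_plus_rf] ev_Cn2[OF _ _ ev_minus_rf] ev_Cn1[OF _ ev_triangle_rf]
        ev_Cn_Sf ev_Pj_eq; simp)+
  then show ?thesis unfolding computable_in_def diagonal_eq_rec by blast
qed

text \<open>The first component is the offset of a code from the triangular number that starts its
  diagonal.\<close>

lemma computable_in_pfst:
  assumes "computable_in X F"
  shows "computable_in X (\<lambda>x. pfst (F x))"
proof -
  have "pfst n = n - triangle (pfst n + psnd n)" for n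
    using prod_decode_inverse[of n] by (simp add: prod_encode_def split_beta)
  moreover have "computable_in X (\<lambda>n. n - triangle (pfst n + psnd n))"
    by (intro computable_in_minus computable_in_triangle computable_in_id computable_in_diagonal)
  ultimately have "computable_in X pfst" by presburger
  then show ?thesis using assms by (rule computable_in_comp)
qed

lemma computable_in_psnd:
  assumes "computable_in X F"
  shows "computable_in X (\<lambda>x. psnd (F x))"
proof -
  have "computable_in X (\<lambda>n. (pfst n + psnd n) - pfst n)"
    by (intro computable_in_minus computable_in_pfst computable_in_id computable_in_diagonal)
  then have "computable_in X psnd" by simp
  then show ?thesis using assms by (rule computable_in_comp)
qed

text \<open>\<open>computable_in\<close> speaks of unary functions, so the step function is assumed
  computable on the code of the triple of counter, previous value and parameter.\<close>

lemma computable_in_rec_nat: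
  assumes "computable_in X G" "computable_in X N"
    and "computable_in X (\<lambda>z. H (pfst z) (pfst (psnd z)) (psnd (psnd z)))"
  shows "computable_in X (\<lambda>x. rec_nat (G x) (\<lambda>n y. H n y x) (N x))"
proof -
  obtain g n h where g: "\<And>x. ev X g [x] (G x)" and n: "\<And>x. ev X n [x] (N x)"
    and h: "\<And>z. ev X h [z] (H (pfst z) (pfst (psnd z)) (psnd (psnd z)))"
    using assms unfolding computable_in_def by blast
  define h' where "h' = Cn h [Cn pair_rf [Pj 0, Cn pair_rf [Pj 1, Pj 2]]]"
  have h': "ev X h' [k, y, x] (H k y x)" for k y x
  proof -
    have "ev X (Cn pair_rf [Pj 0, Cn pair_rf [Pj 1, Pj 2]]) [k, y, x] (prod_encode (k, prod_encode (y, x)))"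
      by (intro ev_Cn2[OF _ _ ev_pair_rf] ev_Pj_eq) (auto simp: arg_def)
    from ev_Cn1[OF this h] show ?thesis by (simp add: h'_def)
  qed
  have "ev X (Cn (Pr g h') [n, Pj 0]) [x] (rec_nat (G x) (\<lambda>n y. H n y x) (N x))" for x
    by (rule ev_Cn2[OF n ev_Pj]) (auto intro!: ev_Pr_rec g h')
  then show ?thesis unfolding computable_in_def by blast
qed

lemma computable_in_mult:
  assumes "computable_in X F" "computable_in X G"
  shows "computable_in X (\<lambda>x. F x * G x)"
proof -
  have "computable_in X (\<lambda>x. rec_nat 0 (\<lambda>n y. y + G x) (F x))"
    by (intro computable_in_rec_nat[where H="\<lambda>n y x. y + G x"] computable_in_const assms computable_in_plus computable_in_pfst
        computable_in_psnd computable_in_id computable_in_comp[OF assms(2)])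
  moreover have "rec_nat 0 (\<lambda>n y. y + b) a = a * b" for a b :: nat
    by (induction a) auto
  ultimately show ?thesis by simp
qed

lemma computable_in_power:
  assumes "computable_in X F"
  shows "computable_in X (\<lambda>x. c ^ F x)"
proof -
  have "computable_in X (\<lambda>x. rec_nat 1 (\<lambda>n y. c * y) (F x))"
    by (intro computable_in_rec_nat[where H="\<lambda>n y x. c * y"] computable_in_const assms computable_in_mult computable_in_pfst
        computable_in_psnd computable_in_id)
  moreover have "rec_nat 1 (\<lambda>n y. c * y) a = c ^ a" for a
    by (induction a) auto
  ultimately show ?thesis by simp
qed

section \<open>Case distinction and decidable predicates\<close>

lemma computable_in_if:
  assumes "decidable_in X P" "computable_in X F" "computable_in X G"
  shows "computable_in X (\<lambda>x. if P x then F x else G x)"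
proof -
  let ?c = "\<lambda>x. if P x then 1 else 0 :: nat"
  have "computable_in X (\<lambda>x. ?c x * F x + (1 - ?c x) * G x)"
    using assms(1) unfolding decidable_in_def
    by (intro computable_in_plus computable_in_mult computable_in_minus computable_in_const assms(2,3))
  moreover have "(\<lambda>x. ?c x * F x + (1 - ?c x) * G x) = (\<lambda>x. if P x then F x else G x)" by auto
  ultimately show ?thesis by simp
qed

lemma decidable_in_comp: "decidable_in X P \<Longrightarrow> computable_in X F \<Longrightarrow> decidable_in X (\<lambda>x. P (F x))"
  unfolding decidable_in_def by (rule computable_in_comp)

lemma decidable_in_const: "decidable_in X (\<lambda>x. c)"
  unfolding decidable_in_def by (rule computable_in_const)

lemma decidable_in_not:
  assumes "decidable_in X P"
  shows "decidable_in X (\<lambda>x. \<not> P x)"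
proof -
  have "computable_in X (\<lambda>x. if P x then 0 else 1)"
    by (intro computable_in_if assms computable_in_const)
  moreover have "(\<lambda>x. if P x then 0 else 1) = (\<lambda>x. if \<not> P x then 1 else 0 :: nat)" by auto
  ultimately show ?thesis by (simp add: decidable_in_def)
qed

lemma decidable_in_conj:
  assumes "decidable_in X P" "decidable_in X Q"
  shows "decidable_in X (\<lambda>x. P x \<and> Q x)"
proof -
  have "computable_in X (\<lambda>x. if P x then if Q x then 1 else 0 else 0)"
    by (intro computable_in_if assms computable_in_const)
  moreover have "(\<lambda>x. if P x then if Q x then 1 else 0 else 0) = (\<lambda>x. if P x \<and> Q x then 1 else 0 :: nat)"
    by auto
  ultimately show ?thesis by (simp add: decidable_in_def)
qed

lemma decidable_in_disj:
  assumes "decidable_in X P" "decidable_in X Q"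
  shows "decidable_in X (\<lambda>x. P x \<or> Q x)"
proof -
  have "decidable_in X (\<lambda>x. \<not> (\<not> P x \<and> \<not> Q x))"
    by (intro decidable_in_not decidable_in_conj assms)
  then show ?thesis by simp
qed

lemma decidable_in_imp:
  "decidable_in X P \<Longrightarrow> decidable_in X Q \<Longrightarrow> decidable_in X (\<lambda>x. P x \<longrightarrow> Q x)"
  unfolding imp_conv_disj by (intro decidable_in_disj decidable_in_not)

lemma decidable_in_le:
  assumes "computable_in X F" "computable_in X G"
  shows "decidable_in X (\<lambda>x. F x \<le> G x)"
proof -
  have "computable_in X (\<lambda>x. 1 - (F x - G x))"
    by (intro computable_in_minus computable_in_const assms)
  moreover have "(\<lambda>x. 1 - (F x - G x)) = (\<lambda>x. if F x \<le> G x then 1 else 0)" by auto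
  ultimately show ?thesis by (simp add: decidable_in_def)
qed

lemma decidable_in_less:
  "computable_in X F \<Longrightarrow> computable_in X G \<Longrightarrow> decidable_in X (\<lambda>x. F x < G x)"
  unfolding not_le[symmetric] by (intro decidable_in_not decidable_in_le)

lemma decidable_in_eq:
  "computable_in X F \<Longrightarrow> computable_in X G \<Longrightarrow> decidable_in X (\<lambda>x. F x = G x)"
  unfolding eq_iff by (intro decidable_in_conj decidable_in_le)

lemma decidable_in_ball_less:
  assumes "computable_in X B" "decidable_in X (\<lambda>z. P (pfst z) (psnd z))"
  shows "decidable_in X (\<lambda>x. \<forall>k<B x. P k x)"
proof -
  have P: "computable_in X F \<Longrightarrow> computable_in X G \<Longrightarrow> decidable_in X (\<lambda>x. P (F x) (G x))" for F G
    using decidable_in_comp[OF assms(2) computable_in_prod_encode, of F G] by simp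
  have "computable_in X (\<lambda>x. rec_nat 1 (\<lambda>k y. if P k x then y else 0) (B x))"
    by (intro computable_in_rec_nat[where H="\<lambda>k y x. if P k x then y else 0"] computable_in_if P
        computable_in_const assms computable_in_pfst computable_in_psnd computable_in_id)
  moreover have "rec_nat 1 (\<lambda>k y. if P k x then y else 0) b = (if \<forall>k<b. P k x then 1 else 0 :: nat)" for b x
    by (induction b) (auto simp: less_Suc_eq)
  ultimately show ?thesis by (simp add: decidable_in_def)
qed

lemma decidable_in_bex_less:
  assumes "computable_in X B" "decidable_in X (\<lambda>z. P (pfst z) (psnd z))"
  shows "decidable_in X (\<lambda>x. \<exists>k<B x. P k x)"
proof -
  have "decidable_in X (\<lambda>x. \<not> (\<forall>k<B x. \<not> P k x))"
    by (intro decidable_in_not decidable_in_ball_less[where P = "\<lambda>k x. \<not> P k x"] assms)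
  then show ?thesis by simp
qed

text \<open>For a bound \<open>k\<close> fixed in advance each \<open>P j\<close> may have its own
  program, without uniformity in \<open>j\<close>. Quantifiers over matrix indices are treated this
  way.\<close>

lemma decidable_in_ball_const:
  assumes "\<And>j. j < k \<Longrightarrow> decidable_in X (P j)"
  shows "decidable_in X (\<lambda>x. \<forall>j<k::nat. P j x)"
  using assms
proof (induction k)
  case 0
  show ?case using decidable_in_const[of X True] by simp
next
  case (Suc k)
  have "(\<forall>j<Suc k. P j x) \<longleftrightarrow> (\<forall>j<k. P j x) \<and> P k x" for x
    by (auto simp: less_Suc_eq)
  then show ?case using Suc by (simp add: decidable_in_conj)
qed

lemmas computability =
  computable_in_id computable_in_const computable_in_Suc computable_in_plus computable_in_minus
  computable_in_mult computable_in_power computable_in_prod_encode computable_in_pfst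
  computable_in_psnd computable_in_if decidable_in_not decidable_in_conj decidable_in_disj
  decidable_in_imp decidable_in_le decidable_in_less decidable_in_eq decidable_in_ball_less
  decidable_in_bex_less

text \<open>Bit \<open>a\<close> of a number is extracted without division, by a bounded search for
  the quotient and the remainder.\<close>

lemma decidable_in_set_decode:
  assumes "computable_in X F" "computable_in X G"
  shows "decidable_in X (\<lambda>x. F x \<in> set_decode (G x))"
proof -
  have "decidable_in X (\<lambda>x. \<exists>q<Suc (G x). \<exists>r<2 ^ F x. G x = (2 * q + 1) * 2 ^ F x + r)"
    by (intro computability computable_in_comp[OF assms(1)] computable_in_comp[OF assms(2)] assms)
  moreover have "a \<in> set_decode n \<longleftrightarrow> (\<exists>q<Suc n. \<exists>r<2 ^ a. n = (2 * q + 1) * 2 ^ a + r)" for a n :: nat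
  proof
    assume "a \<in> set_decode n"
    then obtain q where q: "n div 2 ^ a = 2 * q + 1" by (auto simp: set_decode_def elim: oddE)
    have "n = (2 * q + 1) * 2 ^ a + n mod 2 ^ a" using q by (metis div_mult_mod_eq)
    moreover have "q < Suc n" using q by (metis add_leE div_le_dividend le_imp_less_Suc mult_2 order_trans)
    ultimately show "\<exists>q<Suc n. \<exists>r<2 ^ a. n = (2 * q + 1) * 2 ^ a + r"
      by (metis mod_less_divisor zero_less_numeral zero_less_power)
  next
    assume "\<exists>q<Suc n. \<exists>r<2 ^ a. n = (2 * q + 1) * 2 ^ a + r"
    then obtain q r where "r < 2 ^ a" "n = r + (2 * q + 1) * 2 ^ a" by (metis add.commute)
    then have "n div 2 ^ a = 2 * q + 1" by (simp only: div_mult_self1) simp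
    then show "a \<in> set_decode n" by (simp add: set_decode_def)
  qed
  ultimately show ?thesis by simp
qed

lemma decidable_in_oracle:
  assumes "computable_in X F"
  shows "decidable_in X (\<lambda>x. F x \<in> X)"
proof (rule decidable_in_comp[OF _ assms])
  show "decidable_in X (\<lambda>x. x \<in> X)"
    unfolding decidable_in_def computable_in_def
    using ev_Orc[of X "[x]" for x] by (intro exI[of _ Orc]) auto
qed

text \<open>\<open>Mn\<close> looks for the value 0 whereas a characteristic function is 1 where the
  predicate holds, so the program searched over is \<open>1 - p\<close>.\<close>

lemma ev_Mn_least:
  assumes p: "\<And>z. ev X p [z] (if P (pfst z) (psnd z) then 1 else 0)" and "P y x"
  obtains "ev X (Mn (Cn minus_rf [Cn Sf [Zf], Cn p [pair_rf]])) [x] (LEAST y. P y x)"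
proof -
  let ?q = "Cn minus_rf [Cn Sf [Zf], Cn p [pair_rf]]"
  have q: "ev X ?q [y, x] (if P y x then 0 else 1)" for y
  proof -
    have "ev X (Cn p [pair_rf]) [y, x] (if P y x then 1 else 0)"
      using ev_Cn1[OF ev_pair_rf p] by simp
    from ev_Cn2[OF ev_Cn_Sf[OF ev_Z] this ev_minus_rf] show ?thesis by (auto split: if_splits)
  qed
  have "P (LEAST y. P y x) x" using assms(2) by (rule LeastI)
  then have "ev X ?q [LEAST y. P y x, x] 0" using q[of "LEAST y. P y x"] by simp
  moreover have "ev X ?q [k, x] 1" if "k < (LEAST y. P y x)" for k
    using q[of k] not_less_Least[OF that] by simp
  ultimately have "ev X (Mn ?q) [x] (LEAST y. P y x)"
    by (intro ev_Mn allI impI) (auto intro!: exI[of _ 1])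
  then show thesis by (rule that)
qed

lemma computable_in_Least:
  assumes "decidable_in X (\<lambda>z. P (pfst z) (psnd z))" "\<And>x. \<exists>y. P y x"
  shows "computable_in X (\<lambda>x. LEAST y. P y x)"
  using assms ev_Mn_least unfolding decidable_in_def computable_in_def by metis

section \<open>Determinism of evaluation and semidecidable sets\<close>

inductive_cases ev_elims:
  "ev X Zf xs z" "ev X Sf xs z" "ev X (Pj i) xs z" "ev X Orc xs z"
inductive_cases ev_CnE: "ev X (Cn f gs) xs z"
inductive_cases ev_Pr0E: "ev X (Pr g h) (0 # xs) z"
inductive_cases ev_PrSE: "ev X (Pr g h) (Suc n # xs) z"
inductive_cases ev_MnE: "ev X (Mn f) xs z"

lemma ev_deterministic: "ev X p xs z \<Longrightarrow> ev X p xs z' \<Longrightarrow> z = z'"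
proof (induction arbitrary: z' rule: ev.induct)
  case (ev_Cn ys gs xs f z)
  from ev_Cn.prems obtain ys' where ys': "length ys' = length gs"
    "\<forall>i<length gs. ev X (gs ! i) xs (ys' ! i)" "ev X f ys' z'"
    by (rule ev_CnE)
  have "ys = ys'"
    using ev_Cn.IH(1) ev_Cn.hyps ys' by (intro nth_equalityI) auto
  then show ?case using ev_Cn.IH(2) ys' by simp
next
  case (ev_Pr0 g xs z h)
  from ev_Pr0.prems show ?case by (rule ev_Pr0E) (rule ev_Pr0.IH)
next
  case (ev_PrS g h n xs y z)
  from ev_PrS.prems obtain y' where "ev X (Pr g h) (n # xs) y'" "ev X h (n # y' # xs) z'"
    by (rule ev_PrSE)
  then show ?case using ev_PrS.IH by metis
next
  case (ev_Mn f n xs)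
  from ev_Mn.prems have n': "ev X f (z' # xs) 0" "\<forall>k<z'. \<exists>v. ev X f (k # xs) v \<and> 0 < v"
    by (auto elim: ev_MnE)
  show ?case
  proof (rule linorder_cases[of n z'])
    assume "n < z'"
    then show ?thesis using n'(2) ev_Mn.IH(1) by blast
  next
    assume "z' < n"
    then show ?thesis using n'(1) ev_Mn.IH(2) by blast
  qed
qed (auto elim: ev_elims)

text \<open>The set is the domain of the unbounded search for \<open>y\<close>; determinism excludes
  that the search halts at a \<open>y\<close> for which \<open>P y x\<close> fails.\<close>

lemma sigma01_in_ex:
  assumes "decidable_in X (\<lambda>z. P (pfst z) (psnd z))"
  shows "sigma01_in X {x. \<exists>y. P y x}"
proof -
  obtain p where p: "\<And>z. ev X p [z] (if P (pfst z) (psnd z) then 1 else 0)"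
    using assms unfolding decidable_in_def computable_in_def by blast
  let ?q = "Cn minus_rf [Cn Sf [Zf], Cn p [pair_rf]]"
  have "P y x" if "ev X (Mn ?q) [x] y" for x y
  proof (rule ccontr)
    assume "\<not> P y x"
    then have "ev X (Cn p [pair_rf]) [y, x] 0"
      using ev_Cn1[OF ev_pair_rf p, of y x] by simp
    from ev_Cn2[OF ev_Cn_Sf[OF ev_Z] this ev_minus_rf] have "ev X ?q [y, x] 1" by simp
    moreover have "ev X ?q [y, x] 0" using that by (auto elim: ev_MnE)
    ultimately show False using ev_deterministic by fastforce
  qed
  then show ?thesis
    unfolding sigma01_in_def
    by (intro exI[of _ "Mn ?q"]) (auto elim: ev_Mn_least[where P = P, OF p])
qed

section \<open>Computations as finite sets of justified facts\<close>

definition code_hd :: "nat \<Rightarrow> nat" where "code_hd x = pfst (x - 1)"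
definition code_tl :: "nat \<Rightarrow> nat" where "code_tl x = psnd (x - 1)"
definition code_cons :: "nat \<Rightarrow> nat \<Rightarrow> nat" where "code_cons a x = Suc (prod_encode (a, x))"
definition code_nth :: "nat \<Rightarrow> nat \<Rightarrow> nat" where
  "code_nth x i = code_hd (rec_nat x (\<lambda>_ y. code_tl y) i)"

lemma code_cons_simps [simp]:
  "code_hd (code_cons a x) = a" "code_tl (code_cons a x) = x" "code_cons a x \<noteq> 0"
  "code_cons a (list_encode xs) = list_encode (a # xs)"
  by (simp_all add: code_hd_def code_tl_def code_cons_def)

lemma code_list_simps [simp]:
  "code_hd (list_encode (a # xs)) = a" "code_tl (list_encode (a # xs)) = list_encode xs"
  "0 < list_encode (a # xs)"
  by (simp_all add: code_hd_def code_tl_def)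

lemma prod_decode_0 [simp]: "prod_decode 0 = (0, 0)"
  by (simp add: prod_decode_def prod_decode_aux.simps)

text \<open>Both sides are 0 past the end of the list: the empty list has code 0, and
  \<open>code_hd\<close> and \<open>code_tl\<close> map 0 to 0.\<close>

lemma code_nth_list_encode: "code_nth (list_encode xs) i = arg i xs"
proof -
  \<comment> \<open>\<open>rec_nat\<close> adds the new tail operation on the outside; moving it to
    the starting value lets the induction pass to \<open>tl xs\<close>.\<close>
  have tl: "rec_nat x (\<lambda>_ y. code_tl y) (Suc i) = rec_nat (code_tl x) (\<lambda>_ y. code_tl y) i" for x i
    by (induction i) auto
  show ?thesis
  proof (induction i arbitrary: xs)
    case 0
    show ?case by (cases xs) (auto simp: code_nth_def code_hd_def)
  next
    case (Suc i)
    have "code_tl (list_encode xs) = list_encode (tl xs)" by (cases xs) (auto simp: code_tl_def)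
    moreover have "arg i (tl xs) = arg (Suc i) xs" by (cases xs) auto
    ultimately show ?case using Suc[of "tl xs"] unfolding code_nth_def tl by simp
  qed
qed

lemma computable_in_code_hd: "computable_in X F \<Longrightarrow> computable_in X (\<lambda>x. code_hd (F x))"
  unfolding code_hd_def by (intro computability)

lemma computable_in_code_tl: "computable_in X F \<Longrightarrow> computable_in X (\<lambda>x. code_tl (F x))"
  unfolding code_tl_def by (intro computability)

lemma computable_in_code_cons:
  "computable_in X F \<Longrightarrow> computable_in X G \<Longrightarrow> computable_in X (\<lambda>x. code_cons (F x) (G x))"
  unfolding code_cons_def by (intro computability)

lemma computable_in_code_nth:
  "computable_in X F \<Longrightarrow> computable_in X G \<Longrightarrow> computable_in X (\<lambda>x. code_nth (F x) (G x))"
  unfolding code_nth_def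
  by (intro computable_in_rec_nat[where H = "\<lambda>_ y _. code_tl y"] computability
      computable_in_code_hd computable_in_code_tl)

lemmas code_computability =
  computability decidable_in_set_decode computable_in_code_hd computable_in_code_tl
  computable_in_code_cons computable_in_code_nth

text \<open>Turns quantifiers over the members of a coded set into bounded ones.\<close>

lemma set_decode_less: "a \<in> set_decode n \<Longrightarrow> a < n"
proof -
  assume "a \<in> set_decode n"
  then have "2 ^ a \<le> n" by (metis even_zero div_less not_le set_decode_def mem_Collect_eq)
  then show "a < n" using less_exp order_less_le_trans by blast
qed

section \<open>Codes of programs and certificates of halting\<close>

fun rf_code :: "rf \<Rightarrow> nat" where
  "rf_code Zf = prod_encode (0, 0)"
| "rf_code Sf = prod_encode (1, 0)"
| "rf_code (Pj i) = prod_encode (2, i)"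
| "rf_code (Cn f gs) = prod_encode (3, prod_encode (rf_code f, list_encode (map rf_code gs)))"
| "rf_code (Pr g h) = prod_encode (4, prod_encode (rf_code g, rf_code h))"
| "rf_code (Mn f) = prod_encode (5, rf_code f)"
| "rf_code Orc = prod_encode (6, 0)"

definition fact_code :: "nat \<Rightarrow> nat \<Rightarrow> nat \<Rightarrow> nat" where
  "fact_code p x z = prod_encode (p, prod_encode (x, z))"

text \<open>\<open>justified A p x z\<close>: the fact that program \<open>p\<close> maps \<open>x\<close> to \<open>z\<close> follows by one rule from
  facts in \<open>A\<close>, for the empty oracle. Tag 7 marks the simultaneous evaluation of a list of programs.
  Every rule descends in the program or in the recursion argument, so a set of facts justified by
  its own members contains true facts only, without any ordering on it.\<close>

definition justified :: "nat set \<Rightarrow> nat \<Rightarrow> nat \<Rightarrow> nat \<Rightarrow> bool" where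
  "justified A p x z \<longleftrightarrow>
    pfst p = 0 \<and> z = 0 \<or>
    pfst p = 1 \<and> z = Suc (code_hd x) \<or>
    pfst p = 2 \<and> z = code_nth x (psnd p) \<or>
    pfst p = 3 \<and> (\<exists>y. fact_code (prod_encode (7, psnd (psnd p))) x y \<in> A \<and>
      fact_code (pfst (psnd p)) y z \<in> A) \<or>
    pfst p = 4 \<and> x \<noteq> 0 \<and>
      (code_hd x = 0 \<and> fact_code (pfst (psnd p)) (code_tl x) z \<in> A \<or>
       code_hd x \<noteq> 0 \<and> (\<exists>y. fact_code p (code_cons (code_hd x - 1) (code_tl x)) y \<in> A \<and>
         fact_code (psnd (psnd p)) (code_cons (code_hd x - 1) (code_cons y (code_tl x))) z \<in> A)) \<or>
    pfst p = 5 \<and> fact_code (psnd p) (code_cons z x) 0 \<in> A \<and>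
      (\<forall>k<z. \<exists>v. fact_code (psnd p) (code_cons k x) v \<in> A \<and> 0 < v) \<or>
    pfst p = 6 \<and> z = 0 \<or>
    pfst p = 7 \<and>
      (psnd p = 0 \<and> z = 0 \<or>
       psnd p \<noteq> 0 \<and> z \<noteq> 0 \<and> fact_code (code_hd (psnd p)) x (code_hd z) \<in> A \<and>
         fact_code (prod_encode (7, code_tl (psnd p))) x (code_tl z) \<in> A)"

definition justified_set :: "nat set \<Rightarrow> bool" where
  "justified_set A \<longleftrightarrow> (\<forall>a\<in>A. justified A (pfst a) (pfst (psnd a)) (psnd (psnd a)))"

text \<open>A form of Kleene's T predicate: \<open>d\<close> codes a finite set of facts certifying
  that program \<open>e\<close> halts on \<open>x\<close>.\<close>

definition halting_proof :: "nat \<Rightarrow> nat \<Rightarrow> nat \<Rightarrow> bool" where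
  "halting_proof e x d \<longleftrightarrow> justified_set (set_decode d) \<and>
     (\<exists>y. fact_code e (list_encode [x]) y \<in> set_decode d)"

lemma justified_mono: "justified A p x z \<Longrightarrow> A \<subseteq> B \<Longrightarrow> justified B p x z"
  unfolding justified_def by (elim disjE conjE) (simp_all, blast+)

lemma justified_setD: "justified_set A \<Longrightarrow> fact_code p x z \<in> A \<Longrightarrow> justified A p x z"
  unfolding justified_set_def fact_code_def by force

lemma fact_code_less: "fact_code p x z \<in> set_decode d \<Longrightarrow> z < d"
  using set_decode_less le_prod_encode_2 unfolding fact_code_def
  by (metis le_less_trans)

text \<open>Bounds the existential quantifiers in \<open>justified\<close>, which makes
  \<open>halting_proof\<close> decidable.\<close>

lemma fact_code_bound:
  "(\<exists>y. fact_code p x y \<in> set_decode d \<and> P y) \<longleftrightarrow> (\<exists>y<d. fact_code p x y \<in> set_decode d \<and> P y)"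
  using fact_code_less by blast

lemma computable_in_fact_code:
  "computable_in X F \<Longrightarrow> computable_in X G \<Longrightarrow> computable_in X H \<Longrightarrow>
    computable_in X (\<lambda>x. fact_code (F x) (G x) (H x))"
  unfolding fact_code_def by (intro computability)

lemma decidable_in_halting_proof:
  assumes "computable_in X E" "computable_in X F" "computable_in X D"
  shows "decidable_in X (\<lambda>x. halting_proof (E x) (F x) (D x))"
proof -
  \<comment> \<open>The term \<open>code_cons x 0\<close> is the code of the one-element list
    \<open>[x]\<close>.\<close>
  have *: "halting_proof e x d \<longleftrightarrow>
      (\<forall>a<d. a \<in> set_decode d \<longrightarrow> justified (set_decode d) (pfst a) (pfst (psnd a)) (psnd (psnd a))) \<and>
      (\<exists>y<d. fact_code e (code_cons x 0) y \<in> set_decode d)" for e x d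
    using fact_code_bound[of e "code_cons x 0" d "\<lambda>_. True"]
    by (auto simp: halting_proof_def justified_set_def code_cons_def set_decode_less)
  show ?thesis
    unfolding * justified_def fact_code_bound
    by (intro code_computability computable_in_fact_code assms computable_in_comp[OF assms(1)]
        computable_in_comp[OF assms(2)] computable_in_comp[OF assms(3)])
qed

section \<open>Soundness and completeness of the certificates\<close>

lemma justified_set_sound:
  assumes A: "justified_set A"
  shows "fact_code (rf_code p) (list_encode xs) z \<in> A \<Longrightarrow> ev {} p xs z"
proof (induction p arbitrary: xs z)
  case Zf
  from justified_setD[OF A Zf] show ?case by (auto simp: justified_def intro: ev_Z)
next
  case Sf
  from justified_setD[OF A Sf] show ?case
    by (cases xs) (auto simp: justified_def code_hd_def arg_def intro: ev_Sf_eq)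
next
  case (Pj i)
  from justified_setD[OF A Pj] show ?case
    by (auto simp: justified_def code_nth_list_encode intro: ev_Pj_eq)
next
  case (Cn f gs)
  \<comment> \<open>Facts with tag 7 are unfolded along the list of programs, and the outer
    induction hypothesis applies to each program in it.\<close>
  have list: "\<exists>ys. y = list_encode ys \<and> length ys = length hs \<and> (\<forall>i<length hs. ev {} (hs ! i) xs (ys ! i))"
    if "set hs \<subseteq> set gs" "fact_code (prod_encode (7, list_encode (map rf_code hs))) (list_encode xs) y \<in> A"
    for hs y
    using that
  proof (induction hs arbitrary: y)
    case Nil
    from justified_setD[OF A Nil(2)] show ?case by (auto simp: justified_def intro!: exI[of _ "[]"])
  next
    case (Cons h hs)
    from justified_setD[OF A Cons.prems(2)]
    have y: "y \<noteq> 0" "fact_code (rf_code h) (list_encode xs) (code_hd y) \<in> A"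
      "fact_code (prod_encode (7, list_encode (map rf_code hs))) (list_encode xs) (code_tl y) \<in> A"
      by (auto simp: justified_def code_hd_def code_tl_def)
    obtain ys where ys: "code_tl y = list_encode ys" "length ys = length hs"
      "\<forall>i<length hs. ev {} (hs ! i) xs (ys ! i)"
      using Cons.IH[OF _ y(3)] Cons.prems(1) by auto
    have "ev {} h xs (code_hd y)" using Cn.IH(2) y(2) Cons.prems(1) by auto
    moreover have "y = list_encode (code_hd y # ys)"
      using y(1) unfolding list_encode.simps ys(1)[symmetric] by (simp add: code_hd_def code_tl_def)
    ultimately show ?case
      using ys by (intro exI[of _ "code_hd y # ys"]) (auto simp: nth_Cons split: nat.split)
  qed
  from justified_setD[OF A Cn.prems] obtain y
    where y: "fact_code (prod_encode (7, list_encode (map rf_code gs))) (list_encode xs) y \<in> A"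
      "fact_code (rf_code f) y z \<in> A"
    by (auto simp: justified_def)
  from list[OF _ y(1)] obtain ys where ys: "y = list_encode ys" "length ys = length gs"
    "\<forall>i<length gs. ev {} (gs ! i) xs (ys ! i)" by auto
  then show ?case using Cn.IH(1) y(2) by (intro ev_Cn) auto
next
  case (Pr g h)
  show ?case
  proof (cases xs)
    case Nil
    with justified_setD[OF A Pr.prems] show ?thesis by (auto simp: justified_def)
  next
    case (Cons n ys)
    \<comment> \<open>A fact about \<open>Pr g h\<close> may rest on another fact about the same
      program with a smaller recursion argument, hence an inner induction on that argument.\<close>
    have "fact_code (rf_code (Pr g h)) (list_encode (n # ys)) z \<in> A \<Longrightarrow> ev {} (Pr g h) (n # ys) z"
    proof (induction n arbitrary: z)
      case 0
      from justified_setD[OF A 0] show ?case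
        by (auto simp: justified_def simp del: list_encode.simps intro: ev_Pr0 Pr.IH)
    next
      case (Suc n)
      from justified_setD[OF A Suc.prems] obtain y where
        "fact_code (rf_code (Pr g h)) (list_encode (n # ys)) y \<in> A"
        "fact_code (rf_code h) (list_encode (n # y # ys)) z \<in> A"
        by (auto simp: justified_def simp del: list_encode.simps)
      then show ?case using Suc.IH Pr.IH(2) by (auto intro: ev_PrS simp del: list_encode.simps)
    qed
    then show ?thesis using Pr.prems Cons by simp
  qed
next
  case (Mn f)
  from justified_setD[OF A Mn.prems] have "fact_code (rf_code f) (list_encode (z # xs)) 0 \<in> A"
    "\<forall>k<z. \<exists>v. fact_code (rf_code f) (list_encode (k # xs)) v \<in> A \<and> 0 < v"
    by (auto simp: justified_def simp del: list_encode.simps)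
  then show ?case using Mn.IH by (intro ev_Mn) blast+
next
  case Orc
  from justified_setD[OF A Orc] show ?case using ev_Orc[of "{}" xs] by (auto simp: justified_def)
qed

definition derivable :: "nat \<Rightarrow> bool" where
  "derivable a \<longleftrightarrow> (\<exists>A. finite A \<and> justified_set A \<and> a \<in> A)"

text \<open>Justification is monotone in the set of facts, so the union of the certificates of the
  premises is justified, and the new fact can be added to it.\<close>

lemma derivable_step:
  assumes "finite B" "\<And>a. a \<in> B \<Longrightarrow> derivable a" "justified B p x z"
  shows "derivable (fact_code p x z)"
proof -
  obtain F where F: "\<And>a. a \<in> B \<Longrightarrow> finite (F a) \<and> justified_set (F a) \<and> a \<in> F a"
    using assms(2) unfolding derivable_def by metis
  let ?A = "insert (fact_code p x z) (\<Union>a\<in>B. F a)"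
  have "justified_set ?A"
    unfolding justified_set_def
  proof
    fix c assume "c \<in> ?A"
    then consider "c = fact_code p x z" | a where "a \<in> B" "c \<in> F a" by blast
    then show "justified ?A (pfst c) (pfst (psnd c)) (psnd (psnd c))"
    proof cases
      case 1
      have "B \<subseteq> ?A" using F by blast
      then show ?thesis using justified_mono[OF assms(3)] 1 by (simp add: fact_code_def)
    next
      case 2
      then have "F a \<subseteq> ?A" by blast
      then show ?thesis using justified_mono F 2 unfolding justified_set_def by metis
    qed
  qed
  moreover have "finite ?A" using F assms(1) by simp
  ultimately show ?thesis unfolding derivable_def by blast
qed

lemma derivable_complete: "ev X p xs z \<Longrightarrow> X = {} \<Longrightarrow> derivable (fact_code (rf_code p) (list_encode xs) z)"
proof (induction rule: ev.induct)
  case (ev_Z xs)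
  show ?case by (rule derivable_step[of "{}"]) (auto simp: justified_def)
next
  case (ev_S xs)
  show ?case by (rule derivable_step[of "{}"]; cases xs) (auto simp: justified_def code_hd_def)
next
  case (ev_Pj i xs)
  show ?case by (rule derivable_step[of "{}"]) (auto simp: justified_def code_nth_list_encode)
next
  case (ev_Cn ys gs xs f z)
  have "derivable (fact_code (prod_encode (7, list_encode (map rf_code gs))) (list_encode xs) (list_encode ys))"
    using ev_Cn.hyps(1) ev_Cn.IH(1)
  proof (induction ys gs rule: list_induct2)
    case Nil
    show ?case by (rule derivable_step[of "{}"]) (auto simp: justified_def)
  next
    case (Cons y ys g gs)
    have "derivable (fact_code (rf_code g) (list_encode xs) y)"
      using Cons.prems ev_Cn.prems by force
    moreover have "derivable (fact_code (prod_encode (7, list_encode (map rf_code gs))) (list_encode xs) (list_encode ys))"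
      using Cons.prems by (intro Cons.IH) force
    ultimately show ?case
      by (intro derivable_step[of "{fact_code (rf_code g) (list_encode xs) y,
          fact_code (prod_encode (7, list_encode (map rf_code gs))) (list_encode xs) (list_encode ys)}"])
        (auto simp: justified_def code_hd_def code_tl_def)
  qed
  then show ?case using ev_Cn.IH(2) ev_Cn.prems
    by (intro derivable_step[of "{fact_code (prod_encode (7, list_encode (map rf_code gs))) (list_encode xs) (list_encode ys),
          fact_code (rf_code f) (list_encode ys) z}"])
       (auto simp: justified_def)
next
  case (ev_Pr0 g xs z h)
  then show ?case
    by (intro derivable_step[of "{fact_code (rf_code g) (list_encode xs) z}"])
      (auto simp: justified_def simp del: list_encode.simps)
next
  case (ev_PrS g h n xs y z)
  then show ?case
    by (intro derivable_step[of "{fact_code (rf_code (Pr g h)) (list_encode (n # xs)) y,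
        fact_code (rf_code h) (list_encode (n # y # xs)) z}"])
      (auto simp: justified_def simp del: list_encode.simps)
next
  case (ev_Mn f n xs)
  then obtain v where v: "\<And>k. k < n \<Longrightarrow> derivable (fact_code (rf_code f) (list_encode (k # xs)) (v k)) \<and> 0 < v k"
    by metis
  show ?case using ev_Mn.IH(1) ev_Mn.prems v
    by (intro derivable_step[of "insert (fact_code (rf_code f) (list_encode (n # xs)) 0)
        ((\<lambda>k. fact_code (rf_code f) (list_encode (k # xs)) (v k)) ` {..<n})"])
      (auto simp: justified_def simp del: list_encode.simps)
next
  case (ev_Orc xs)
  then show ?case by (intro derivable_step[of "{}"]) (auto simp: justified_def)
qed

lemma halting_proof_iff: "(\<exists>d. halting_proof (rf_code p) x d) \<longleftrightarrow> (\<exists>y. ev {} p [x] y)"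
proof
  assume "\<exists>d. halting_proof (rf_code p) x d"
  then show "\<exists>y. ev {} p [x] y" using justified_set_sound unfolding halting_proof_def by blast
next
  assume "\<exists>y. ev {} p [x] y"
  then obtain y where "ev {} p [x] y" ..
  from derivable_complete[OF this refl] obtain A where
    "finite A" "justified_set A" "fact_code (rf_code p) (list_encode [x]) y \<in> A"
    unfolding derivable_def by blast
  then have "halting_proof (rf_code p) x (set_encode A)"
    unfolding halting_proof_def by (auto simp: set_encode_inverse simp del: list_encode.simps)
  then show "\<exists>d. halting_proof (rf_code p) x d" ..
qed

section \<open>The diagonal set\<close>

text \<open>A witness \<open>w\<close> codes a halting computation together with the pair it enumerates.\<close>

abbreviation left_set :: "nat \<Rightarrow> nat set" where "left_set w \<equiv> set_decode (pfst (psnd w))"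
abbreviation right_set :: "nat \<Rightarrow> nat set" where "right_set w \<equiv> set_decode (psnd (psnd w))"

definition witness :: "nat \<Rightarrow> nat \<Rightarrow> nat \<Rightarrow> bool" where
  "witness e h w \<longleftrightarrow> halting_proof e (psnd w) (pfst w) \<and>
    (\<forall>a<w. (a \<in> left_set w \<or> a \<in> right_set w \<longrightarrow> h \<le> a) \<and> \<not> (a \<in> left_set w \<and> a \<in> right_set w))"

text \<open>Members of both sets of a witness are smaller than its code, so adding the code makes
  later stages start beyond them. The extra 1 makes the bounds strictly increasing.\<close>

definition next_bound :: "nat \<Rightarrow> nat \<Rightarrow> nat" where
  "next_bound e h = (if \<exists>w. witness e h w then h + (LEAST w. witness e h w) + 1 else h + 1)"

definition bound :: "nat \<Rightarrow> nat" where "bound n = rec_nat 0 next_bound n"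

text \<open>Stage \<open>e\<close> only acts on numbers from \<open>bound e\<close> on, and
  \<open>e \<le> bound e\<close>, so nothing is lost by considering only stages up to
  \<open>x\<close>.\<close>

definition diag_set :: "nat set" where
  "diag_set = {x. \<exists>e<Suc x. (\<exists>w. witness e (bound e) w) \<and> x \<in> right_set (LEAST w. witness e (bound e) w)}"

text \<open>The disjunct \<open>b \<le> w\<close> makes the search total; the value \<open>b\<close>
  signals that there is no witness below \<open>b\<close>.\<close>

definition witness_below :: "nat \<Rightarrow> nat \<Rightarrow> nat \<Rightarrow> nat" where
  "witness_below b e h = (LEAST w. b \<le> w \<or> witness e h w)"

definition next_bound_below :: "nat \<Rightarrow> nat \<Rightarrow> nat \<Rightarrow> nat" where
  "next_bound_below b e h = (if witness_below b e h < b then h + witness_below b e h + 1 else h + 1)"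

definition bound_below :: "nat \<Rightarrow> nat \<Rightarrow> nat" where
  "bound_below b n = rec_nat 0 (next_bound_below b) n"

definition diag_approx :: "nat \<Rightarrow> nat \<Rightarrow> bool" where
  "diag_approx b x \<longleftrightarrow> (\<exists>e<Suc x. witness_below b e (bound_below b e) < b \<and>
     x \<in> right_set (witness_below b e (bound_below b e)))"

section \<open>Computability of the approximation\<close>

lemma mem_sets_less: "a \<in> left_set w \<or> a \<in> right_set w \<Longrightarrow> a < w"
proof -
  have "pfst (psnd w) \<le> psnd w" "psnd (psnd w) \<le> psnd w" "psnd w \<le> w"
    by (metis prod.collapse prod_decode_inverse le_prod_encode_1 le_prod_encode_2)+
  then show "a \<in> left_set w \<or> a \<in> right_set w \<Longrightarrow> a < w"
    using set_decode_less by (meson less_le_trans order_trans)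
qed

text \<open>The bound on \<open>a\<close> in the definition only serves decidability, since members
  of both sets are below \<open>w\<close> anyway.\<close>

lemma witness_iff:
  "witness e h w \<longleftrightarrow> halting_proof e (psnd w) (pfst w) \<and>
    (\<forall>a\<in>left_set w \<union> right_set w. h \<le> a) \<and> left_set w \<inter> right_set w = {}"
  unfolding witness_def using mem_sets_less by blast

lemma decidable_in_witness:
  assumes "computable_in X E" "computable_in X H" "computable_in X W"
  shows "decidable_in X (\<lambda>x. witness (E x) (H x) (W x))"
  unfolding witness_def
  by (intro code_computability decidable_in_halting_proof assms
      computable_in_comp[OF assms(1)] computable_in_comp[OF assms(2)] computable_in_comp[OF assms(3)])

lemma computable_in_witness_below:
  assumes "computable_in X B" "computable_in X E" "computable_in X H"
  shows "computable_in X (\<lambda>x. witness_below (B x) (E x) (H x))"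
  unfolding witness_below_def
  by (intro computable_in_Least[where P = "\<lambda>w x. B x \<le> w \<or> witness (E x) (H x) w"]
      computability decidable_in_witness
      computable_in_comp[OF assms(1)] computable_in_comp[OF assms(2)] computable_in_comp[OF assms(3)])
    blast

lemma computable_in_bound_below:
  assumes "computable_in X B" "computable_in X E"
  shows "computable_in X (\<lambda>x. bound_below (B x) (E x))"
  unfolding bound_below_def next_bound_below_def
  by (intro computable_in_rec_nat[where H = "\<lambda>e h x. if witness_below (B x) e h < B x
        then h + witness_below (B x) e h + 1 else h + 1"]
      computability computable_in_witness_below assms
      computable_in_comp[OF assms(1)] computable_in_comp[OF assms(2)])

lemma decidable_in_diag_approx:
  assumes "computable_in X B" "computable_in X F"
  shows "decidable_in X (\<lambda>x. diag_approx (B x) (F x))"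
  unfolding diag_approx_def
  by (intro code_computability computable_in_witness_below computable_in_bound_below assms
      computable_in_comp[OF assms(1)] computable_in_comp[OF assms(2)])

section \<open>Convergence of the approximation\<close>

lemma witness_below_eventually:
  "\<forall>\<^sub>F b in sequentially. (witness_below b e h < b \<longleftrightarrow> (\<exists>w. witness e h w)) \<and>
     ((\<exists>w. witness e h w) \<longrightarrow> witness_below b e h = (LEAST w. witness e h w))"
proof (cases "\<exists>w. witness e h w")
  case True
  define v where "v = (LEAST w. witness e h w)"
  have v: "witness e h v" "\<And>w. witness e h w \<Longrightarrow> v \<le> w"
    using True unfolding v_def by (auto intro: LeastI_ex Least_le)
  have "witness_below b e h = v" if "v < b" for b
    unfolding witness_below_def by (rule Least_equality) (use v that in auto)
  then show ?thesis
    using True unfolding eventually_sequentially v_def[symmetric] by (metis Suc_le_lessD)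
next
  case False
  have "witness_below b e h = b" for b
    unfolding witness_below_def by (rule Least_equality) (use False in auto)
  then show ?thesis using False by simp
qed

text \<open>A stage depends on earlier ones only through its bound. Once that bound is correct, the
  next one is correct as soon as \<open>b\<close> exceeds the least witness, if there is
  one.\<close>

lemma bound_below_eventually: "\<forall>\<^sub>F b in sequentially. bound_below b n = bound n"
proof (induction n)
  case 0
  show ?case by (simp add: bound_below_def bound_def)
next
  case (Suc n)
  then show ?case
    using witness_below_eventually[of n "bound n"]
  proof eventually_elim
    case (elim b)
    have "bound_below b (Suc n) = next_bound_below b n (bound n)"
      using elim(1) by (simp add: bound_below_def)
    also have "\<dots> = next_bound n (bound n)"
      using elim(2) by (auto simp: next_bound_below_def next_bound_def)
    finally show ?case by (simp add: bound_def)
  qed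
qed

text \<open>Only the finitely many stages up to \<open>x\<close> matter, so their limits can be
  taken simultaneously.\<close>

lemma diag_approx_eventually: "\<forall>\<^sub>F b in sequentially. diag_approx b x \<longleftrightarrow> x \<in> diag_set"
proof -
  have "\<forall>\<^sub>F b in sequentially. \<forall>e\<in>{..<Suc x}. (witness_below b e (bound_below b e) < b \<and>
      x \<in> right_set (witness_below b e (bound_below b e))) \<longleftrightarrow>
      (\<exists>w. witness e (bound e) w) \<and> x \<in> right_set (LEAST w. witness e (bound e) w)"
  proof (intro eventually_ball_finite ballI finite_lessThan)
    fix e
    show "\<forall>\<^sub>F b in sequentially. (witness_below b e (bound_below b e) < b \<and>
      x \<in> right_set (witness_below b e (bound_below b e))) \<longleftrightarrow>
      (\<exists>w. witness e (bound e) w) \<and> x \<in> right_set (LEAST w. witness e (bound e) w)"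
      using bound_below_eventually[of e] witness_below_eventually[of e "bound e"]
      by eventually_elim auto
  qed
  then show ?thesis
    unfolding diag_approx_def diag_set_def mem_Collect_eq
    by (rule eventually_mono) (metis (no_types, lifting) lessThan_iff)
qed

section \<open>The diagonal set against enumerated families of pairs\<close>

lemma bound_mono: "i \<le> j \<Longrightarrow> bound i \<le> bound j"
proof (induction rule: dec_induct)
  case (step n)
  then show ?case by (auto simp: bound_def next_bound_def)
qed simp

lemma le_bound: "n \<le> bound n"
  by (induction n) (auto simp: bound_def next_bound_def)

text \<open>Distinct stages act on disjoint intervals, so no stage can spoil what another has
  decided.\<close>

lemma least_witness_bounds:
  assumes "witness e (bound e) w" and "v = (LEAST w. witness e (bound e) w)"
    and "a \<in> left_set v \<union> right_set v"
  shows "bound e \<le> a" "a < bound (Suc e)"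
proof -
  have v: "witness e (bound e) v" using assms(1) unfolding assms(2) by (rule LeastI)
  then show "bound e \<le> a" using assms(3) unfolding witness_iff by blast
  have "a < v" using assms(3) mem_sets_less by blast
  then show "a < bound (Suc e)"
    using assms(1,2) by (auto simp: bound_def next_bound_def)
qed

text \<open>Take the stage whose index codes a program for \<open>E\<close>; it finds a witness
  because \<open>E\<close> has members beyond its bound. The right half enters
  \<open>diag_set\<close> at this stage. The left half stays out: it is disjoint from the right
  half, and other stages act on other intervals.\<close>

lemma diag_set_meets:
  assumes "sigma01_in {} E"
    and large: "\<And>s. \<exists>L R. finite L \<and> finite R \<and> L \<inter> R = {} \<and> (\<forall>a\<in>L \<union> R. s \<le> a) \<and>
      prod_encode (set_encode L, set_encode R) \<in> E"
  shows "\<exists>L R. finite L \<and> finite R \<and> L \<inter> diag_set = {} \<and> R \<subseteq> diag_set \<and>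
    prod_encode (set_encode L, set_encode R) \<in> E"
proof -
  obtain p where "\<And>x. x \<in> E \<longleftrightarrow> (\<exists>y. ev {} p [x] y)"
    using assms(1) unfolding sigma01_in_def by blast
  then have E: "\<And>x. x \<in> E \<longleftrightarrow> (\<exists>d. halting_proof (rf_code p) x d)"
    by (simp add: halting_proof_iff)
  define e where "e = rf_code p"
  obtain L R where LR: "finite L" "finite R" "L \<inter> R = {}" "\<forall>a\<in>L \<union> R. bound e \<le> a"
    "prod_encode (set_encode L, set_encode R) \<in> E"
    using large[of "bound e"] by blast
  obtain d where "halting_proof e (prod_encode (set_encode L, set_encode R)) d"
    using LR(5) E e_def by blast
  then have ex: "witness e (bound e) (prod_encode (d, prod_encode (set_encode L, set_encode R)))"
    using LR by (simp add: witness_iff set_encode_inverse)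
  \<comment> \<open>The stage acts on the least witness, whose pair may differ from the pair
    \<open>L\<close>, \<open>R\<close> just obtained.\<close>
  define w where "w = (LEAST w. witness e (bound e) w)"
  have w: "witness e (bound e) w" using ex unfolding w_def by (rule LeastI)
  have "psnd w \<in> E" using w E e_def unfolding witness_iff by blast
  then have mem: "prod_encode (set_encode (left_set w), set_encode (right_set w)) \<in> E" by simp
  have "right_set w \<subseteq> diag_set"
  proof
    fix x assume x: "x \<in> right_set w"
    then have "e < Suc x" using least_witness_bounds(1)[OF w w_def, of x] le_bound[of e] by auto
    then show "x \<in> diag_set" using x w unfolding diag_set_def w_def by blast
  qed
  moreover have False if x: "x \<in> left_set w" "x \<in> diag_set" for x
  proof -
    obtain i w' where i: "witness i (bound i) w'" "x \<in> right_set (LEAST w. witness i (bound i) w)"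
      using x(2) unfolding diag_set_def by blast
    have "i = e"
    proof (rule linorder_cases[of i e])
      assume "i < e"
      then show ?thesis using least_witness_bounds[OF i(1) refl] i(2) least_witness_bounds[OF w w_def] x(1)
          bound_mono[of "Suc i" e] by fastforce
    next
      assume "e < i"
      then show ?thesis using least_witness_bounds[OF i(1) refl] i(2) least_witness_bounds[OF w w_def] x(1)
          bound_mono[of "Suc e" i] by fastforce
    qed
    then show False using i(2) x(1) w unfolding witness_iff w_def by blast
  qed
  ultimately show ?thesis using mem
    by (intro exI[of _ "left_set w"] exI[of _ "right_set w"]) (auto simp: finite_set_decode)
qed

text \<open>The easy half of Shoenfield's limit lemma: membership means that the approximation says
  yes at all stages \<open>y + z\<close> for some \<open>y\<close>, and the complement is treated in
  the same way.\<close>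

lemma delta02_limit:
  assumes dec: "decidable_in {} (\<lambda>n. P (pfst n) (psnd n))"
    and lim: "\<And>x. \<forall>\<^sub>F b in sequentially. P b x \<longleftrightarrow> x \<in> S"
  shows "delta02 S"
proof -
  have sigma: "sigma02 T"
    if dec: "decidable_in {} (\<lambda>n. Q (pfst n) (psnd n))"
      and lim: "\<And>x. \<forall>\<^sub>F b in sequentially. Q b x \<longleftrightarrow> x \<in> T" for Q T
  proof -
    have "decidable_in {} (\<lambda>n. Q (pfst (psnd n) + psnd (psnd n)) (pfst n))"
      using decidable_in_comp[OF dec, of "\<lambda>n. prod_encode (pfst (psnd n) + psnd (psnd n), pfst n)"]
      by (simp add: computability)
    then have "computable_set {n. Q (pfst (psnd n) + psnd (psnd n)) (pfst n)}"
      by (simp add: computable_set_def decidable_in_def)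
    moreover have "x \<in> T \<longleftrightarrow> (\<exists>y. \<forall>z. Q (y + z) x)" for x
    proof -
      obtain N where N: "\<And>b. b \<ge> N \<Longrightarrow> Q b x \<longleftrightarrow> x \<in> T"
        using lim unfolding eventually_sequentially by blast
      show ?thesis
      proof
        assume "x \<in> T"
        then show "\<exists>y. \<forall>z. Q (y + z) x" using N by (intro exI[of _ N]) auto
      next
        assume "\<exists>y. \<forall>z. Q (y + z) x"
        then obtain y where "\<forall>z. Q (y + z) x" ..
        then show "x \<in> T" using N[of "y + N"] by auto
      qed
    qed
    ultimately show ?thesis
      unfolding sigma02_def by (intro exI[of _ "{n. Q (pfst (psnd n) + psnd (psnd n)) (pfst n)}"]) auto
  qed
  have "\<forall>\<^sub>F b in sequentially. \<not> P b x \<longleftrightarrow> x \<in> - S" for x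
    using lim by (rule eventually_mono) auto
  then show ?thesis
    unfolding delta02_def using sigma[OF dec lim] sigma[OF decidable_in_not[OF dec]] by blast
qed

section \<open>Strings, valuations and fairness\<close>

lemma computable_in_list_encode_map:
  assumes "\<And>i. i \<in> set is \<Longrightarrow> computable_in X (F i)"
  shows "computable_in X (\<lambda>x. list_encode (map (\<lambda>i. F i x) is))"
  using assms by (induction "is") (auto intro!: computability)

text \<open>Codes are bijective base-2 numerals with digits 1 and 2, the first entry being least
  significant, so a prefix is the low-order part.\<close>

lemma str_code_append: "str_code (s @ t) = str_code t * 2 ^ length s + str_code s"
  by (induction s) (auto simp: algebra_simps)

lemma inj_str_code: "inj str_code"
proof (rule injI)
  show "str_code s = str_code t \<Longrightarrow> s = t" for s t
  proof (induction s arbitrary: t)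
    case Nil
    then show ?case by (cases t) (auto split: if_splits)
  next
    case (Cons b s)
    then obtain c t' where t: "t = c # t'" by (cases t) (auto split: if_splits)
    have *: "2 * str_code s + (if b then 2 else 1) = 2 * str_code t' + (if c then 2 else 1)"
      using Cons.prems t by simp
    have "b = c" using arg_cong[OF *, of even] by (auto split: if_splits)
    with * have "str_code s = str_code t'" by simp
    then show ?case using Cons.IH t \<open>b = c\<close> by simp
  qed
qed

lemma surj_str_code: "surj str_code"
proof -
  have "\<exists>s. str_code s = n" for n
  proof (induction n rule: less_induct)
    case (less n)
    show ?case
    proof (cases "n = 0")
      case True
      then show ?thesis by (intro exI[of _ "[]"]) simp
    next
      case False
      obtain s where s: "str_code s = (n - 1) div 2" using less.IH[of "(n - 1) div 2"] False by force
      \<comment> \<open>The lowest digit is 2 exactly when \<open>n\<close> is even, and removing it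
        leaves \<open>(n - 1) div 2\<close>.\<close>
      have "str_code (even n # s) = n"
        using False s by (cases "even n") (auto elim!: evenE oddE)
      then show ?thesis ..
    qed
  qed
  then show ?thesis by (metis surjI)
qed

lemma str_code_inv: "str_code (inv str_code a) = a"
  by (rule surj_f_inv_f[OF surj_str_code])

lemma length_le_str_code: "length s \<le> str_code s"
  by (induction s) auto

text \<open>By surjectivity every quotient \<open>q\<close> is the code of a string, namely of the
  remaining suffix. The bounded search makes extending a fixed string decidable.\<close>

lemma prefix_iff_str_code:
  "prefix s t \<longleftrightarrow> (\<exists>q<Suc (str_code t). str_code t = q * 2 ^ length s + str_code s)"
proof
  assume "prefix s t"
  then obtain r where r: "t = s @ r" by (elim prefixE)
  have "str_code r \<le> str_code r * 2 ^ length s" by simp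
  then have "str_code r < Suc (str_code t)" unfolding r str_code_append by linarith
  then show "\<exists>q<Suc (str_code t). str_code t = q * 2 ^ length s + str_code s"
    using r by (intro exI[of _ "str_code r"]) (simp add: str_code_append)
next
  assume "\<exists>q<Suc (str_code t). str_code t = q * 2 ^ length s + str_code s"
  then obtain q where "str_code t = q * 2 ^ length s + str_code s" by blast
  then have "str_code t = str_code (s @ inv str_code q)" by (simp add: str_code_append str_code_inv)
  then show "prefix s t" using injD[OF inj_str_code] by fastforce
qed

text \<open>Every number decodes to an array of finite sets, so a search over valuations becomes a
  search over numbers.\<close>

definition decode_val :: "nat \<Rightarrow> nat \<Rightarrow> nat \<Rightarrow> str set" where
  "decode_val u i j = str_code -` set_decode (code_nth (code_nth u i) j)"

lemma finite_decode_val: "finite (decode_val u i j)"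
  unfolding decode_val_def by (rule finite_vimageI[OF finite_set_decode inj_str_code])

lemma decode_val_val_code:
  assumes "i < m" "j < k" "finite (V i j)"
  shows "decode_val (val_code m k V) i j = V i j"
  using assms unfolding decode_val_def val_code_def code_nth_list_encode fset_code_def
  by (simp add: arg_def code_nth_list_encode set_encode_inverse inj_vimage_image_eq[OF inj_str_code])

lemma val_code_decode_val_val_code:
  assumes "\<forall>i<m. \<forall>j<k. finite (V i j)"
  shows "val_code m k (decode_val (val_code m k V)) = val_code m k V"
proof -
  have "fset_code (decode_val (val_code m k V) i j) = fset_code (V i j)" if "i < m" "j < k" for i j
    using decode_val_val_code that assms by simp
  then show ?thesis unfolding val_code_def by (auto intro!: arg_cong[of _ _ list_encode])
qed

text \<open>Decoding and recoding normalises an arbitrary number to a genuine valuation code, about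
  which membership in an enumerable set can be asked.\<close>

lemma computable_in_val_code:
  assumes "computable_in X F"
  shows "computable_in X (\<lambda>x. val_code m k (decode_val (F x)))"
proof -
  have "fset_code (decode_val u i j) = code_nth (code_nth u i) j" for u i j
    by (simp add: fset_code_def decode_val_def image_vimage_eq surj_str_code)
  then show ?thesis
    unfolding val_code_def
    by (simp add: computable_in_list_encode_map code_computability assms)
qed

text \<open>The relation \<open>Q\<close> on string codes and parameters covers cones, coded finite
  sets and the complement of an oracle.\<close>

lemma decidable_in_decode_val_subset:
  assumes "computable_in X F" "decidable_in X (\<lambda>z. Q (pfst z) (psnd z))"
  shows "decidable_in X (\<lambda>x. decode_val (F x) i j \<subseteq> {\<sigma>. Q (str_code \<sigma>) x})"
proof -
  have *: "decode_val u i j \<subseteq> {\<sigma>. Q (str_code \<sigma>) x} \<longleftrightarrow>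
      (\<forall>a<code_nth (code_nth u i) j. a \<in> set_decode (code_nth (code_nth u i) j) \<longrightarrow> Q a x)" for u x
    using set_decode_less str_code_inv by (fastforce simp: decode_val_def)
  show ?thesis
    unfolding * by (intro code_computability assms computable_in_comp[OF assms(1)])
qed

lemma decidable_in_valuation:
  assumes "computable_in X F"
  shows "decidable_in X (\<lambda>x. valuation m k M (decode_val (F x)))"
proof -
  have "decidable_in X (\<lambda>z. \<exists>q<Suc (pfst z). pfst z = q * 2 ^ length \<sigma> + str_code \<sigma>)" for \<sigma>
    by (intro computability)
  from decidable_in_decode_val_subset[OF assms, OF this]
  have "decidable_in X (\<lambda>x. decode_val (F x) i j \<subseteq> {\<tau>. prefix (M i j) \<tau>})" for i j
    by (simp only: prefix_iff_str_code)
  then have "decidable_in X (\<lambda>x. \<forall>i<m. \<forall>j<k. decode_val (F x) i j \<subseteq> {\<tau>. prefix (M i j) \<tau>})"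
    by (intro decidable_in_ball_const)
  then show ?thesis unfolding valuation_def by (simp add: finite_decode_val)
qed

text \<open>Choosing a longest available string first, each choice excludes at most one string of every
  other antichain, namely a prefix of it.\<close>

lemma parallel_choice:
  assumes "finite T" "\<And>t. t \<in> T \<Longrightarrow> finite (P t) \<and> card T \<le> card (P t)"
    and "\<And>t s s'. t \<in> T \<Longrightarrow> s \<in> P t \<Longrightarrow> s' \<in> P t \<Longrightarrow> s \<noteq> s' \<Longrightarrow> parallel s s'"
  shows "\<exists>c. (\<forall>t\<in>T. c t \<in> P t) \<and> (\<forall>t\<in>T. \<forall>u\<in>T. t \<noteq> u \<longrightarrow> parallel (c t) (c u))"
  using assms
proof (induction "card T" arbitrary: T P)
  case 0
  then show ?case by simp
next
  case (Suc n)
  note P = Suc.prems(2) and antichain = Suc.prems(3)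
  have "T \<noteq> {}" using Suc.hyps(2) by auto
  then obtain t0 where "t0 \<in> T" by blast
  then have "P t0 \<noteq> {}" using P[of t0] Suc.hyps(2) by auto
  define Z where "Z = (\<Union>t\<in>T. P t)"
  have "finite Z" "Z \<noteq> {}" using Suc.prems(1) P \<open>t0 \<in> T\<close> \<open>P t0 \<noteq> {}\<close> by (auto simp: Z_def)
  then have "Max (length ` Z) \<in> length ` Z" by simp
  then obtain s where s: "s \<in> Z" "length s = Max (length ` Z)" by auto
  then have longest: "\<And>u r. u \<in> T \<Longrightarrow> r \<in> P u \<Longrightarrow> length r \<le> length s"
    unfolding s(2) using \<open>finite Z\<close> by (intro Max_ge) (auto simp: Z_def)
  obtain t where t: "t \<in> T" "s \<in> P t" using s(1) by (auto simp: Z_def)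
  define P' where "P' = (\<lambda>u. {r \<in> P u. parallel s r})"
  have card: "card (T - {t}) \<le> card (P' u)" if u: "u \<in> T" for u
  proof -
    have sub: "P u - P' u \<subseteq> {r. prefix r s}"
    proof
      fix r assume "r \<in> P u - P' u"
      then have "prefix s r \<or> prefix r s" "length r \<le> length s"
        using longest u by (auto simp: P'_def parallel_def)
      then show "r \<in> {r. prefix r s}"
        by (metis mem_Collect_eq not_equal_is_parallel parallel_def prefix_length_le prefix_order.eq_iff le_antisym)
    qed
    \<comment> \<open>Two prefixes of \<open>s\<close> are comparable, so an antichain contains at
      most one.\<close>
    have "r = r'" if "r \<in> P u - P' u" "r' \<in> P u - P' u" for r r'
    proof (rule ccontr)
      assume "r \<noteq> r'"
      then have "parallel r r'" using antichain[OF u] that by blast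
      moreover have "prefix r s" "prefix r' s" using sub that by auto
      ultimately show False using prefix_same_cases unfolding parallel_def by blast
    qed
    then have "card (P u - P' u) \<le> 1" by (metis One_nat_def card_le_Suc0_iff_eq P finite_Diff u)
    moreover have "card (P u) = card (P' u) + card (P u - P' u)"
      using P[OF u] card_Diff_subset[of "P' u" "P u"] card_mono[of "P u" "P' u"]
      by (simp add: P'_def)
    ultimately show ?thesis using conjunct2[OF P[OF u]] card_Diff_singleton[OF t(1)] by linarith
  qed
  have "n = card (T - {t})" using Suc.hyps(2) t(1) by (simp add: card_Diff_singleton)
  moreover have "finite (T - {t})" using Suc.prems(1) by simp
  moreover have "finite (P' u) \<and> card (T - {t}) \<le> card (P' u)" if "u \<in> T - {t}" for u
    using card P that by (auto simp: P'_def)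
  moreover have "parallel r r'" if "u \<in> T - {t}" "r \<in> P' u" "r' \<in> P' u" "r \<noteq> r'" for u r r'
    using antichain[of u r r'] that by (auto simp: P'_def)
  ultimately obtain c where c: "\<forall>u\<in>T - {t}. c u \<in> P' u"
    "\<forall>u\<in>T - {t}. \<forall>v\<in>T - {t}. u \<noteq> v \<longrightarrow> parallel (c u) (c v)"
    using Suc.hyps(1)[of "T - {t}" P'] by blast
  have "\<forall>u\<in>T. (c(t := s)) u \<in> P u" using c(1) t by (auto simp: P'_def)
  moreover have "\<forall>u\<in>T. \<forall>v\<in>T. u \<noteq> v \<longrightarrow> parallel ((c(t := s)) u) ((c(t := s)) v)"
    using c by (auto simp: P'_def parallel_commute)
  ultimately show ?case by blast
qed

section \<open>Fairness of the empty oracle\<close>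

lemma disjoint_matrix_choice:
  assumes "disjoint_matrix m (2 * m) M"
  shows "\<exists>l r. (\<forall>i<m. l i < 2 * m \<and> r i < 2 * m) \<and>
    (\<forall>i<m. \<forall>i'<m. parallel (M i (l i)) (M i' (r i')))"
proof -
  \<comment> \<open>The indices \<open>2 * i\<close> and \<open>2 * i + 1\<close> both draw from row
    \<open>i\<close>; there are \<open>2 * m\<close> draws, and each row is an antichain of that
    size.\<close>
  let ?P = "\<lambda>t. M (t div 2) ` {..<2 * m}"
  have inj: "inj_on (M i) {..<2 * m}" if "i < m" for i
    using assms that unfolding disjoint_matrix_def inj_on_def by force
  obtain c where c: "\<forall>t\<in>{..<2 * m}. c t \<in> ?P t"
    "\<forall>t\<in>{..<2 * m}. \<forall>u\<in>{..<2 * m}. t \<noteq> u \<longrightarrow> parallel (c t) (c u)"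
  proof (atomize_elim, rule parallel_choice)
    fix t assume "t \<in> {..<2 * m}"
    then have "t div 2 < m" by auto
    then show "finite (?P t) \<and> card {..<2 * m} \<le> card (?P t)"
      using inj by (simp add: card_image)
  next
    fix t s s' assume "t \<in> {..<2 * m}" "s \<in> ?P t" "s' \<in> ?P t" "s \<noteq> s'"
    moreover from this(1) have "t div 2 < m" by auto
    ultimately show "parallel s s'"
      using assms unfolding disjoint_matrix_def by auto
  qed simp
  have "\<exists>j<2 * m. M i j = c (2 * i)" "\<exists>j<2 * m. M i j = c (2 * i + 1)" if "i < m" for i
    using c(1)[rule_format, of "2 * i"] c(1)[rule_format, of "2 * i + 1"] that by auto
  then obtain l r where lr: "\<And>i. i < m \<Longrightarrow> l i < 2 * m \<and> M i (l i) = c (2 * i)"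
    "\<And>i. i < m \<Longrightarrow> r i < 2 * m \<and> M i (r i) = c (2 * i + 1)"
    by metis
  have "parallel (M i (l i)) (M i' (r i'))" if "i < m" "i' < m" for i i'
  proof -
    have "2 * i \<noteq> 2 * i' + 1" by presburger
    then show ?thesis using lr that c(2) by auto
  qed
  then show ?thesis using lr by blast
qed

lemma n_fair_diag_set: "n_fair 1 {} {\<sigma>. str_code \<sigma> \<notin> diag_set} {\<sigma>. str_code \<sigma> \<in> diag_set}"
  unfolding n_fair_def power_one_right
proof (intro allI impI)
  fix m \<phi> M
  assume formula: "sigma01_formula {} m (2 * m) \<phi>" and disjoint: "disjoint_matrix m (2 * m) M"
    and essential: "essential m (2 * m) \<phi> M"
  define k where "k = 2 * m"
  obtain W p where W: "\<And>V. \<forall>i<m. \<forall>j<k. finite (V i j) \<Longrightarrow> \<phi> V \<longleftrightarrow> val_code m k V \<in> W"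
    and "\<And>x. x \<in> W \<longleftrightarrow> (\<exists>y. ev {} p [x] y)"
    using formula unfolding sigma01_formula_def sigma01_in_def k_def by blast
  then have p: "\<And>x. x \<in> W \<longleftrightarrow> (\<exists>d. halting_proof (rf_code p) x d)"
    by (simp add: halting_proof_iff)
  obtain l r where "\<forall>i<m. l i < k \<and> r i < k" "\<forall>i<m. \<forall>i'<m. parallel (M i (l i)) (M i' (r i'))"
    using disjoint_matrix_choice[OF disjoint] unfolding k_def by (elim exE conjE)
  then have lr: "\<And>i. i < m \<Longrightarrow> l i < k \<and> r i < k"
    and par: "\<And>i i'. i < m \<Longrightarrow> i' < m \<Longrightarrow> parallel (M i (l i)) (M i' (r i'))"
    by simp_all
  \<comment> \<open>Inclusion is enough here, because diagonalizing only asks for components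
    contained in \<open>A0\<close> or \<open>A1\<close>.\<close>
  define captured where "captured = (\<lambda>u x. valuation m k M (decode_val u) \<and>
    (\<forall>i<m. decode_val u i (l i) \<subseteq> {\<sigma>. str_code \<sigma> \<in> set_decode (pfst x)}) \<and>
    (\<forall>i<m. decode_val u i (r i) \<subseteq> {\<sigma>. str_code \<sigma> \<in> set_decode (psnd x)}))"
  \<comment> \<open>The number \<open>y\<close> pairs a valuation with a certificate that its code
    is enumerated into \<open>W\<close>, which gives \<open>E\<close> the existential form required
    of an enumerable set.\<close>
  define E where "E = {x. \<exists>y. halting_proof (rf_code p) (val_code m k (decode_val (pfst y))) (psnd y) \<and>
    captured (pfst y) x}"
  have E: "x \<in> E \<longleftrightarrow> (\<exists>u. val_code m k (decode_val u) \<in> W \<and> captured u x)" for x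
  proof
    assume "x \<in> E"
    then show "\<exists>u. val_code m k (decode_val u) \<in> W \<and> captured u x"
      unfolding E_def p mem_Collect_eq by (elim exE conjE) (intro exI conjI)
  next
    assume "\<exists>u. val_code m k (decode_val u) \<in> W \<and> captured u x"
    then obtain u d where "halting_proof (rf_code p) (val_code m k (decode_val u)) d" "captured u x"
      unfolding p by (elim exE conjE)
    then show "x \<in> E"
      unfolding E_def mem_Collect_eq by (intro exI[of _ "prod_encode (u, d)"]) simp
  qed
  have sigma: "sigma01_in {} E"
    unfolding E_def captured_def
    by (intro sigma01_in_ex decidable_in_conj decidable_in_halting_proof computable_in_val_code
        decidable_in_valuation decidable_in_ball_const
        decidable_in_decode_val_subset[where Q = "\<lambda>a z. a \<in> set_decode (pfst (psnd z))"]
        decidable_in_decode_val_subset[where Q = "\<lambda>a z. a \<in> set_decode (psnd (psnd z))"]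
        decidable_in_set_decode computability)
  have large: "\<exists>L R. finite L \<and> finite R \<and> L \<inter> R = {} \<and> (\<forall>a\<in>L \<union> R. s \<le> a) \<and>
      prod_encode (set_encode L, set_encode R) \<in> E" for s
  proof -
    obtain V where V: "valuation m k M V" "val_gt m k V s" "\<phi> V"
      using essential unfolding essential_def k_def by blast
    then have fin: "\<forall>i<m. \<forall>j<k. finite (V i j)" and cone: "\<And>i j \<sigma>. i < m \<Longrightarrow> j < k \<Longrightarrow> \<sigma> \<in> V i j \<Longrightarrow> prefix (M i j) \<sigma>"
      unfolding valuation_def by blast+
    \<comment> \<open>The selected components of all rows are merged, so that a single member of
      \<open>E\<close> serves every row at once.\<close>
    let ?L = "\<Union>i<m. str_code ` V i (l i)" and ?R = "\<Union>i<m. str_code ` V i (r i)"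
    let ?u = "val_code m k V"
    have dec: "\<And>i j. i < m \<Longrightarrow> j < k \<Longrightarrow> decode_val ?u i j = V i j"
      using fin decode_val_val_code by blast
    have "finite ?L" "finite ?R" using fin lr by auto
    moreover have "?L \<inter> ?R = {}"
    proof -
      \<comment> \<open>A common string would extend a left and a right entry, which are
        incomparable even when they come from different rows.\<close>
      have False if "i < m" "i' < m" "\<sigma> \<in> V i (l i)" "\<tau> \<in> V i' (r i')" "str_code \<sigma> = str_code \<tau>" for i i' \<sigma> \<tau>
      proof -
        have "prefix (M i (l i)) \<sigma>" "prefix (M i' (r i')) \<sigma>"
          using cone lr that injD[OF inj_str_code that(5)] by auto
        then show False using par[OF that(1,2)] prefix_same_cases unfolding parallel_def by blast
      qed
      then show ?thesis by auto
    qed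
    moreover have "\<forall>a\<in>?L \<union> ?R. s \<le> a"
    proof -
      have "s \<le> str_code \<sigma>" if "i < m" "j < k" "\<sigma> \<in> V i j" for i j \<sigma>
        using V(2) that length_le_str_code[of \<sigma>] unfolding val_gt_def by fastforce
      then show ?thesis using lr by auto
    qed
    moreover have "prod_encode (set_encode ?L, set_encode ?R) \<in> E"
    proof -
      have "val_code m k (decode_val ?u) \<in> W"
        using V(3) W[OF fin] val_code_decode_val_val_code[OF fin] by simp
      moreover have "captured ?u (prod_encode (set_encode ?L, set_encode ?R))"
        using V(1) lr \<open>finite ?L\<close> \<open>finite ?R\<close>
        by (auto simp: captured_def dec valuation_def set_encode_inverse)
      ultimately show ?thesis unfolding E by blast
    qed
    ultimately show ?thesis by blast
  qed
  obtain L R where LR: "finite L" "finite R" "L \<inter> diag_set = {}" "R \<subseteq> diag_set"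
    "prod_encode (set_encode L, set_encode R) \<in> E"
    using diag_set_meets[OF sigma large] by (elim exE conjE)
  then obtain u where u: "val_code m k (decode_val u) \<in> W"
    "captured u (prod_encode (set_encode L, set_encode R))"
    unfolding E by (elim exE conjE)
  let ?V = "decode_val u"
  have "\<phi> ?V" using u(1) W by (simp add: finite_decode_val)
  moreover have "valuation m k M ?V" using u(2) by (simp add: captured_def)
  moreover have "diagonalizes m k ?V {\<sigma>. str_code \<sigma> \<notin> diag_set} {\<sigma>. str_code \<sigma> \<in> diag_set}"
    unfolding diagonalizes_def
  proof (intro allI impI)
    fix i assume i: "i < m"
    have "?V i (l i) \<subseteq> {\<sigma>. str_code \<sigma> \<in> L}" "?V i (r i) \<subseteq> {\<sigma>. str_code \<sigma> \<in> R}"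
      using u(2) i LR(1,2) by (simp_all add: captured_def set_encode_inverse)
    then show "\<exists>l<k. \<exists>r<k. ?V i l \<subseteq> {\<sigma>. str_code \<sigma> \<notin> diag_set} \<and> ?V i r \<subseteq> {\<sigma>. str_code \<sigma> \<in> diag_set}"
      using lr[OF i] LR(3,4) by blast
  qed
  ultimately show "\<exists>V. valuation m (2 * m) M V \<and>
      diagonalizes m (2 * m) V {\<sigma>. str_code \<sigma> \<notin> diag_set} {\<sigma>. str_code \<sigma> \<in> diag_set} \<and> \<phi> V"
    unfolding k_def by blast
qed

section \<open>Homogeneous sets are not fair\<close>

lemma infinite_extensions: "infinite {\<tau> :: str. strict_prefix \<sigma> \<tau>}"
proof -
  have "inj (\<lambda>n. \<sigma> @ True # replicate n True)" by (rule injI) simp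
  then have "infinite (range (\<lambda>n. \<sigma> @ True # replicate n True))" by (simp add: finite_image_iff)
  then show ?thesis by (rule infinite_super[rotated]) (auto simp: strict_prefix_def)
qed

text \<open>The injective \<open>g\<close> carries the infinitely many proper extensions of \<sigma>
  to extensions of \<open>g \<sigma>\<close> in \<open>S\<close>, too many for a finite set.\<close>

lemma homogeneous_extension:
  assumes "homogeneous f S g" "finite N"
  shows "\<exists>\<tau>\<in>S. strict_prefix (g \<sigma>) \<tau> \<and> \<tau> \<notin> N"
proof -
  have g: "inj g" "g ` UNIV = S" "\<And>\<sigma> \<tau>. prefix \<sigma> \<tau> \<longleftrightarrow> prefix (g \<sigma>) (g \<tau>)"
    using assms(1) unfolding homogeneous_def bij_betw_def by blast+
  have "infinite (g ` {\<tau>. strict_prefix \<sigma> \<tau>})"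
    using infinite_extensions finite_imageD inj_on_subset[OF g(1)] by blast
  then obtain \<tau> where "strict_prefix \<sigma> \<tau>" "g \<tau> \<notin> N"
    using assms(2) by (metis (no_types, lifting) finite_subset image_subsetI mem_Collect_eq)
  then show ?thesis using g(2,3) injD[OF g(1)] unfolding strict_prefix_def by (intro bexI[of _ "g \<tau>"]) auto
qed

text \<open>One row refutes fairness for every \<open>n\<close>: diagonalizing needs a component
  inside \<open>A0\<close> and one inside \<open>A1\<close>, and one of these would miss
  \<open>S\<close>.\<close>

lemma not_n_fair_of_monochromatic:
  assumes hom: "homogeneous f S g" and mono: "S \<inter> A0 = {} \<or> S \<inter> A1 = {}"
  shows "\<not> n_fair n (str_code ` S) A0 A1"
proof
  assume fair: "n_fair n (str_code ` S) A0 A1"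
  define k :: nat where "k = 2 ^ n * 1"
  have gS: "\<And>\<sigma>. g \<sigma> \<in> S" and gp: "\<And>\<sigma> \<tau>. prefix \<sigma> \<tau> \<longleftrightarrow> prefix (g \<sigma>) (g \<tau>)"
    using hom unfolding homogeneous_def bij_betw_def by blast+
  \<comment> \<open>The strings of \<open>j\<close> times \<open>True\<close> followed by
    \<open>False\<close> form an infinite antichain, which provides rows of any length.\<close>
  define M where "M = (\<lambda>(i::nat) j. g (replicate j True @ [False]))"
  define \<phi> where "\<phi> = (\<lambda>V :: nat \<Rightarrow> nat \<Rightarrow> str set. \<forall>j<k. V 0 j \<inter> S \<noteq> {})"
  \<comment> \<open>Meeting \<open>S\<close> is phrased as not being included in its complement, to
    fit \<open>decidable_in_decode_val_subset\<close>.\<close>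
  define W where "W = {v. \<forall>j<k. \<not> decode_val v 0 j \<subseteq> {\<sigma>. str_code \<sigma> \<notin> str_code ` S}}"
  have "decidable_in (str_code ` S) (\<lambda>v. v \<in> W)"
    unfolding W_def mem_Collect_eq
    by (intro decidable_in_ball_const decidable_in_not computability decidable_in_oracle
        decidable_in_decode_val_subset[where Q = "\<lambda>a _. a \<notin> str_code ` S"])
  then have "sigma01_in (str_code ` S) W"
    using sigma01_in_ex[of "str_code ` S" "\<lambda>_ v. v \<in> W"] decidable_in_comp[of "str_code ` S" "\<lambda>v. v \<in> W" psnd]
    by (simp add: computability)
  moreover have "\<phi> V \<longleftrightarrow> val_code 1 k V \<in> W" if "\<forall>i<1. \<forall>j<k. finite (V i j)" for V
    using decode_val_val_code[of 0 1 _ k V] that inj_image_mem_iff[OF inj_str_code]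
    by (auto simp: \<phi>_def W_def)
  ultimately have "sigma01_formula (str_code ` S) 1 k \<phi>"
    unfolding sigma01_formula_def by blast
  moreover have "disjoint_matrix 1 k M"
  proof -
    have "parallel (replicate j True @ [False]) (replicate j' True @ [False])" if less: "j < j'" for j j'
    proof -
      obtain i where "j' = j + Suc i" using less_imp_Suc_add[OF less] by auto
      then have "replicate j' True @ [False] = replicate j True @ replicate (Suc i) True @ [False]"
        by (simp only: replicate_add append_assoc)
      then show ?thesis by (auto simp: parallel_def)
    qed
    then have "parallel (replicate j True @ [False]) (replicate j' True @ [False])" if "j \<noteq> j'" for j j'
      using that by (metis linorder_neqE_nat parallel_commute)
    then show ?thesis unfolding disjoint_matrix_def M_def parallel_def using gp by blast
  qed
  moreover have "essential 1 k \<phi> M"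
    unfolding essential_def
  proof
    fix s
    have "\<exists>\<tau>\<in>S. prefix (M 0 j) \<tau> \<and> s < length \<tau>" for j
    proof -
      have "finite {\<tau> :: str. length \<tau> \<le> s}"
        using finite_lists_length_le[of "UNIV :: bool set" s] by simp
      from homogeneous_extension[OF hom this] show ?thesis
        unfolding M_def by (auto simp: strict_prefix_def not_le)
    qed
    then obtain t where t: "\<And>j. t j \<in> S \<and> prefix (M 0 j) (t j) \<and> s < length (t j)" by metis
    then show "\<exists>V. valuation 1 k M V \<and> val_gt 1 k V s \<and> \<phi> V"
      by (intro exI[of _ "\<lambda>i j. {t j}"]) (auto simp: valuation_def val_gt_def \<phi>_def)
  qed
  ultimately obtain V where V: "diagonalizes 1 k V A0 A1" "\<phi> V"
    using fair unfolding n_fair_def k_def by blast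
  then obtain l r where "l < k" "r < k" "V 0 l \<subseteq> A0" "V 0 r \<subseteq> A1"
    unfolding diagonalizes_def by auto
  then show False using V(2) mono unfolding \<phi>_def by blast
qed

section \<open>The partition and the colouring\<close>

theorem mainTheorem6:
  shows "\<exists>A0 A1 f.
     A0 \<union> A1 = UNIV \<and> A0 \<inter> A1 = {} \<and> delta02 (str_code ` A0) \<and>
     n_fair 1 {} A0 A1 \<and> computable_coloring f \<and>
     (\<forall>S g. homogeneous f S g \<longrightarrow> (\<forall>n\<ge>1. \<not> n_fair n (str_code ` S) A0 A1))"
proof (intro exI conjI allI impI)
  let ?A0 = "{\<sigma>. str_code \<sigma> \<notin> diag_set}" and ?A1 = "{\<sigma>. str_code \<sigma> \<in> diag_set}"
  let ?f = "\<lambda>\<sigma> \<tau>. diag_approx (str_code \<tau>) (str_code \<sigma>)"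
  show "?A0 \<union> ?A1 = UNIV" "?A0 \<inter> ?A1 = {}" by auto
  show "n_fair 1 {} ?A0 ?A1" by (rule n_fair_diag_set)
  have "str_code ` ?A0 = - diag_set"
    using image_vimage_eq[of str_code "- diag_set"] by (simp add: surj_str_code vimage_def)
  moreover have "delta02 (- diag_set)"
  proof (rule delta02_limit)
    show "decidable_in {} (\<lambda>n. \<not> diag_approx (pfst n) (psnd n))"
      by (intro decidable_in_not decidable_in_diag_approx computability)
    show "\<forall>\<^sub>F b in sequentially. (\<not> diag_approx b x) = (x \<in> - diag_set)" for x
      using diag_approx_eventually[of x] by (rule eventually_mono) simp
  qed
  ultimately show "delta02 (str_code ` ?A0)" by simp
  have "decidable_in {} (\<lambda>n. diag_approx (psnd n) (pfst n))"
    by (intro decidable_in_diag_approx computability)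
  then show "computable_coloring ?f"
    unfolding computable_coloring_def decidable_in_def by (simp add: str_code_inv split_beta)
  fix S g n
  assume hom: "homogeneous ?f S g" and "1 \<le> (n::nat)"
  obtain c where c: "\<forall>\<sigma>\<in>S. \<forall>\<tau>\<in>S. strict_prefix \<sigma> \<tau> \<longrightarrow> ?f \<sigma> \<tau> = c"
    using hom unfolding homogeneous_def by (elim conjE exE)
  have "(str_code \<sigma> \<in> diag_set) = c" if "\<sigma> \<in> S" for \<sigma>
  proof -
    obtain b where b: "\<forall>t\<ge>b. diag_approx t (str_code \<sigma>) \<longleftrightarrow> str_code \<sigma> \<in> diag_set"
      using diag_approx_eventually[of "str_code \<sigma>"] unfolding eventually_sequentially by (elim exE)
    obtain \<rho> where \<rho>: "\<sigma> = g \<rho>"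
      using hom \<open>\<sigma> \<in> S\<close> unfolding homogeneous_def bij_betw_def by blast
    \<comment> \<open>Only finitely many strings have a code below \<open>b\<close>, so some
      extension of \<sigma> in \<open>S\<close> reads the approximation after it has
      settled.\<close>
    have "finite (str_code -` {..<b})"
      by (rule finite_vimageI[OF finite_lessThan inj_str_code])
    then obtain \<tau> where "\<tau> \<in> S" "strict_prefix \<sigma> \<tau>" "\<tau> \<notin> str_code -` {..<b}"
      using homogeneous_extension[OF hom] unfolding \<rho> by blast
    then show ?thesis using b[rule_format, of "str_code \<tau>"] c[rule_format, OF that, of \<tau>] by simp
  qed
  then have "S \<inter> ?A0 = {} \<or> S \<inter> ?A1 = {}" by (cases c) auto
  then show "\<not> n_fair n (str_code ` S) ?A0 ?A1"
    by (rule not_n_fair_of_monochromatic[OF hom])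
qed

end
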